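(* There is an absolute constant $c>0$ such that the following holds. Let $n \geq 1$ be an integer, let $M$ satisfy $1 \leq M \leq \frac14 \exp\left(\frac n9\right)$, and let $a_0,a_1,\ldots,a_n \in [1,M]$. Set $a := \left(\frac{\log(4M)}{n}\right)^{1/2}$ (so that $a \leq 1/3$) and $I_a := (1-2a,1-a)$. Then there are $b_0,b_1,\ldots,b_n \in \{-1,0,1\}$ such that the polynomial $P(z) = \sum_{j=0}^n b_j a_j z^j$ has at least $c\left(\frac{n}{\log(4M)}\right)^{1/2} - 1$ distinct sign changes in $I_a$. *)

theory Defs
  imports Complex_Main
begin

text \<open>
  The function \<open>f\<close> changes sign at \<open>x\<close> if it is nonzero and of one sign immediately to the left
  of \<open>x\<close>, and nonzero and of the opposite sign immediately to the right of \<open>x\<close>. For a nonzero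
  polynomial these are the zeros of odd multiplicity; the zero polynomial changes sign nowhere.
\<close>
definition changes_sign_at :: "(real \<Rightarrow> real) \<Rightarrow> real \<Rightarrow> bool" where
  "changes_sign_at f x \<longleftrightarrow>
     (\<exists>s\<in>{-1, 1}. (\<forall>\<^sub>F y in at_left x. sgn (f y) = s) \<and> (\<forall>\<^sub>F y in at_right x. sgn (f y) = - s))"

definition sign_changes_in :: "(real \<Rightarrow> real) \<Rightarrow> real set \<Rightarrow> real set" where
  "sign_changes_in f I = {x \<in> I. changes_sign_at f x}"

end

theory Submission imports Defs "HOL-Analysis.Analysis" begin

text \<open>
  Write \<open>L = ln (4 M)\<close> and \<open>\<alpha> = sqrt (L / n)\<close>. Fix nodes \<open>y\<^sub>0, \<dots>, y\<^sub>K\<close> in geometric progression in the interval,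
  with \<open>K\<close> of order \<open>L / \<alpha>\<close>. By the pigeonhole principle there is a nonzero admissible polynomial \<open>P\<close> for which
  the first \<open>m\<close> moments of the sequence \<open>P (y\<^sub>i)\<close> are smaller than \<open>exp (- C L / \<alpha>)\<close>, with \<open>m\<close> of order \<open>1 / \<alpha>\<close>.
  If \<open>P\<close> had fewer than \<open>m\<close> sign changes, a polynomial in \<open>i\<close> of degree below \<open>m\<close>, with half-integer zeros,
  would have the sign pattern of this sequence, and all \<open>P (y\<^sub>i)\<close> would be tiny. But they cannot all be smaller than
  \<open>exp (- C' L / \<alpha>)\<close>: along the nodes, \<open>\<Sum>\<^sub>i w\<^sub>i P (y\<^sub>i) = \<Sum>\<^sub>j b\<^sub>j a\<^sub>j exp (- \<tau> j) W (exp (- h j))\<close> with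
  \<open>W (q) = \<Sum>\<^sub>i w\<^sub>i q ^ i\<close>, and a polynomial of Coppersmith--Rivlin type (value \<open>1\<close> at the index \<open>0\<close>, small at all
  positive integers) isolates the lowest coefficient.
\<close>

section \<open>A discrete Chebyshev polynomial\<close>

lemma power_div_fact_le_exp:
  fixes x :: real
  assumes "0 \<le> x"
  shows "x ^ k / fact k \<le> exp x"
proof -
  have s: "summable (\<lambda>i. x ^ i /\<^sub>R fact i)" by (rule summable_exp_generic)
  have "sum (\<lambda>i. x ^ i /\<^sub>R fact i) {k} \<le> (\<Sum>i. x ^ i /\<^sub>R fact i)"
    by (rule sum_le_suminf[OF s]) (use assms in auto)
  then show ?thesis by (simp add: exp_def divide_inverse mult.commute)
qed

lemma self_power_div_fact_le: "real k ^ k / fact k \<le> exp (real k)"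
  by (rule power_div_fact_le_exp) simp

text \<open>Passing from \<open>N\<close> to \<open>Suc N\<close> multiplies the quotient by
  \<open>(D + N + 1) / (D - N)\<close>. Since \<open>D - N\<close> is at least \<open>D / 2\<close>,
  this is at most \<open>exp (2 * (2 * N + 1) / D)\<close>, and the odd numbers
  \<open>2 * N + 1\<close> add up to a square.\<close>

lemma central_factorial_quotient_le:
  fixes N D :: nat
  assumes "2 * N < D"
  shows "fact (D - N) * fact (D + N) / (fact D)\<^sup>2 \<le> exp (2 * (real N)\<^sup>2 / real D)"
  using assms
proof (induction N)
  case 0
  show ?case by (simp add: power2_eq_square)
next
  case (Suc N)
  then have IH: "fact (D - N) * fact (D + N) / (fact D)\<^sup>2 \<le> exp (2 * (real N)\<^sup>2 / real D)" by simp
  have D: "real D > 0" "real D - real N > 0" using Suc.prems by auto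
  have "D - N = Suc (D - Suc N)" using Suc.prems by simp
  then have f1: "fact (D - N) = (real D - real N) * fact (D - Suc N)"
    using Suc.prems by (simp add: of_nat_diff)
  have f2: "fact (D + Suc N) = (real D + real N + 1) * fact (D + N)" by (simp add: algebra_simps)
  have "(real D + real N + 1) / (real D - real N) = 1 + (2 * real N + 1) / (real D - real N)"
    using D by (simp add: field_simps)
  also have "(2 * real N + 1) / (real D - real N) \<le> (2 * real N + 1) / (real D / 2)"
    using D Suc.prems by (intro divide_left_mono) auto
  also have "1 + (2 * real N + 1) / (real D / 2) \<le> exp ((2 * real N + 1) / (real D / 2))"
    by (rule exp_ge_add_one_self)
  finally have ratio: "(real D + real N + 1) / (real D - real N) \<le> exp ((2 * real N + 1) * 2 / real D)"
    by simp
  have "fact (D - Suc N) * fact (D + Suc N) / (fact D)\<^sup>2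
      = fact (D - N) * fact (D + N) / (fact D)\<^sup>2 * ((real D + real N + 1) / (real D - real N))"
    unfolding f1 f2 using D by simp
  also have "\<dots> \<le> exp (2 * (real N)\<^sup>2 / real D) * exp ((2 * real N + 1) * 2 / real D)"
    using IH ratio D by (intro mult_mono) auto
  also have "\<dots> = exp (2 * (real (Suc N))\<^sup>2 / real D)"
    using D by (simp add: exp_add[symmetric] field_simps power2_eq_square)
  finally show ?case .
qed

text \<open>Each numerator splits as \<open>(i - N) * (i + N)\<close>, so the product telescopes
  into factorials. This serves the factors with \<open>i > u\<close> in the estimate of the
  truncated sine product, where \<open>N\<close> is the floor of \<open>u\<close>.\<close>

lemma prod_squares_above:
  fixes N D :: nat
  assumes "N \<le> D"
  shows "(\<Prod>i=N+1..D. ((real i)\<^sup>2 - (real N)\<^sup>2) / (real i)\<^sup>2)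
    = fact (D - N) * fact (D + N) * (fact N)\<^sup>2 / (fact (2 * N) * (fact D)\<^sup>2)"
  using assms
proof (induction D rule: dec_induct)
  case base
  show ?case by (simp add: mult_2)
next
  case (step D)
  have f: "fact (Suc D - N) = (real D + 1 - real N) * fact (D - N)"
    "fact (Suc D + N) = (real D + 1 + real N) * fact (D + N)"
    "fact (Suc D) = (real D + 1) * fact D"
    using step.hyps by (simp_all add: Suc_diff_le of_nat_diff algebra_simps)
  have sq: "(real D + 1)\<^sup>2 - (real N)\<^sup>2 = (real D + 1 - real N) * (real D + 1 + real N)"
    by (simp add: power2_eq_square algebra_simps)
  have "(\<Prod>i=N+1..Suc D. ((real i)\<^sup>2 - (real N)\<^sup>2) / (real i)\<^sup>2)
     = (\<Prod>i=N+1..D. ((real i)\<^sup>2 - (real N)\<^sup>2) / (real i)\<^sup>2) * (((real D + 1)\<^sup>2 - (real N)\<^sup>2) / (real D + 1)\<^sup>2)"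
    using step.hyps by (simp add: add.commute)
  also have "\<dots> = fact (Suc D - N) * fact (Suc D + N) * (fact N)\<^sup>2 / (fact (2 * N) * (fact (Suc D))\<^sup>2)"
    unfolding step.IH f sq by (simp add: power_mult_distrib mult_ac)
  finally show ?case .
qed

text \<open>The counterpart for the factors with \<open>i\<close> at most the floor of
  \<open>u\<close>, where \<open>u\<close> is replaced by \<open>N + 1\<close>. The upper limit
  \<open>m\<close> is kept apart from \<open>N\<close> for the induction, though only
  \<open>m = N\<close> is needed later. The factor 36 is the square of \<open>fact 3\<close>,
  because the product starts at 4.\<close>

lemma prod_squares_below:
  fixes N m :: nat
  assumes "3 \<le> m" "m \<le> N"
  shows "(\<Prod>i=4..m. ((real N + 1)\<^sup>2 - (real i)\<^sup>2) / (real i)\<^sup>2)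
    = fact (N - 3) * fact (N + 1 + m) * 36 / (fact (N - m) * fact (N + 4) * (fact m)\<^sup>2)"
  using assms
proof (induction m rule: dec_induct)
  case base
  show ?case by (simp add: fact_numeral add.commute)
next
  case (step m)
  have "N - m = Suc (N - Suc m)" using step.prems by simp
  then have f: "fact (N - m) = (real N - real m) * fact (N - Suc m)"
    "fact (N + 1 + Suc m) = (real N + 2 + real m) * fact (N + 1 + m)"
    "fact (Suc m) = (real m + 1) * fact m"
    using step.prems by (simp_all add: of_nat_diff algebra_simps)
  have p: "real N - real m > 0" using step.prems by simp
  have "(\<Prod>i=4..Suc m. ((real N + 1)\<^sup>2 - (real i)\<^sup>2) / (real i)\<^sup>2)
     = (\<Prod>i=4..m. ((real N + 1)\<^sup>2 - (real i)\<^sup>2) / (real i)\<^sup>2) * (((real N + 1)\<^sup>2 - (real m + 1)\<^sup>2) / (real m + 1)\<^sup>2)"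
    using step.hyps by (simp add: add.commute)
  also have "(real N + 1)\<^sup>2 - (real m + 1)\<^sup>2 = (real N - real m) * (real N + 2 + real m)"
    by (simp add: power2_eq_square algebra_simps)
  also have "(\<Prod>i=4..m. ((real N + 1)\<^sup>2 - (real i)\<^sup>2) / (real i)\<^sup>2)
      = fact (N - 3) * fact (N + 1 + m) * 36 / (fact (N - m) * fact (N + 4) * (fact m)\<^sup>2)"
    using step by simp
  also have "fact (N - 3) * fact (N + 1 + m) * 36 / (fact (N - m) * fact (N + 4) * (fact m)\<^sup>2)
       * ((real N - real m) * (real N + 2 + real m) / (real m + 1)\<^sup>2)
     = fact (N - 3) * fact (N + 1 + Suc m) * 36 / (fact (N - Suc m) * fact (N + 4) * (fact (Suc m))\<^sup>2)"
    unfolding f using p by (simp add: power_mult_distrib mult_ac del: fact_Suc distrib_left_numeral distrib_right_numeral)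
  finally show ?case .
qed

text \<open>Here \<open>u / i\<close> is at least 1/2 for every \<open>i\<close>, and
  \<open>\<bar>1 - t\<bar> \<le> 4 * t\<close> for \<open>t \<ge> 1/4\<close>. So the product is at
  most the full product of \<open>(2 * u / i)\<close> squared, bounded by
  \<open>exp (4 * u)\<close>, divided by its first three factors, which are of order
  \<open>u ^ 6\<close>. Finally \<open>4 * u\<close> is at most \<open>8 * u^2 / D\<close> because
  \<open>D\<close> is at most \<open>2 * u\<close>.\<close>

lemma prod_squares_le_of_large:
  fixes u :: real and D :: nat
  assumes "3 \<le> u" "4 \<le> D" "real D \<le> 2 * u"
  shows "(\<Prod>i=4..D. \<bar>1 - u\<^sup>2 / (real i)\<^sup>2\<bar>) \<le> 81 / (2 * exp 1 * u ^ 4) * exp (8 * u\<^sup>2 / real D)"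
proof -
  let ?g = "\<lambda>i. (2 * u)\<^sup>2 / (real i)\<^sup>2"
  have "(\<Prod>i=4..D. \<bar>1 - u\<^sup>2 / (real i)\<^sup>2\<bar>) \<le> (\<Prod>i=4..D. ?g i)"
  proof (intro prod_mono conjI)
    fix i assume i: "i \<in> {4..D}"
    then have "real i \<le> 2 * u" using assms by auto
    then have "(real i)\<^sup>2 \<le> (2 * u)\<^sup>2" by (intro power_mono) auto
    moreover have "(real i)\<^sup>2 > 0" using i by auto
    ultimately have "u\<^sup>2 / (real i)\<^sup>2 \<ge> 1/4" by (simp add: field_simps)
    moreover have "?g i = 4 * (u\<^sup>2 / (real i)\<^sup>2)" by (simp add: power_mult_distrib)
    ultimately show "\<bar>1 - u\<^sup>2 / (real i)\<^sup>2\<bar> \<le> ?g i" by linarith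
  qed simp
  also have "(\<Prod>i=4..D. ?g i) = (\<Prod>i=1..D. ?g i) / (\<Prod>i=1..3. ?g i)"
  proof -
    have "{1..D} = {1..3} \<union> {4..D}" using assms by auto
    then have "(\<Prod>i=1..D. ?g i) = (\<Prod>i=1..3. ?g i) * (\<Prod>i=4..D. ?g i)"
      by (simp only:) (rule prod.union_disjoint, auto)
    moreover have "(\<Prod>i=1..3. ?g i) \<noteq> 0" using assms by simp
    ultimately show ?thesis by simp
  qed
  also have "(\<Prod>i=1..3. ?g i) = 64 * u ^ 6 / 36"
    by (simp add: numeral_3_eq_3 field_simps power_mult_distrib)
  also have "(\<Prod>i=1..D. ?g i) = ((2 * u) ^ D / fact D)\<^sup>2"
    by (induction D) (simp_all add: power_divide power_mult_distrib mult_ac)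
  also have "((2 * u) ^ D / fact D)\<^sup>2 \<le> (exp (2 * u))\<^sup>2"
    using power_div_fact_le_exp[of "2 * u" D] assms by (intro power_mono) auto
  also have "\<dots> = exp (4 * u)" by (simp add: power2_eq_square exp_add[symmetric])
  also have "\<dots> \<le> exp (8 * u\<^sup>2 / real D)"
    using assms by (simp add: field_simps power2_eq_square)
  finally have "(\<Prod>i=4..D. \<bar>1 - u\<^sup>2 / (real i)\<^sup>2\<bar>) \<le> exp (8 * u\<^sup>2 / real D) / (64 * u ^ 6 / 36)"
    using assms by (simp add: divide_right_mono)
  also have "\<dots> = 36 / (64 * u ^ 6) * exp (8 * u\<^sup>2 / real D)" by simp
  also have "36 / (64 * u ^ 6) \<le> 81 / (2 * exp 1 * u ^ 4)"
  proof -
    have "u\<^sup>2 \<ge> 9" using power_mono[of 3 u 2] assms by simp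
    then have "36 * (2 * exp 1) \<le> 81 * 64 * u\<^sup>2" using exp_le by linarith
    then have "36 * (2 * exp 1) * u ^ 4 \<le> 81 * 64 * u\<^sup>2 * u ^ 4" 
      using assms by (intro mult_right_mono) auto
    then show ?thesis using assms by (simp add: field_simps flip: power_add)
  qed
  finally show ?thesis using assms by (simp add: mult_right_mono)
qed

text \<open>Let \<open>N\<close> be the floor of \<open>u\<close>. Replacing \<open>u\<close> by
  \<open>N + 1\<close> in the factors with \<open>i \<le> N\<close>, and by \<open>N\<close> in the
  others, only enlarges the absolute values and turns both products into quotients of factorials.
  What remains is a rational function of order \<open>N ^ (-6)\<close> times a central factorial
  quotient.\<close>

lemma prod_squares_le_of_small:
  fixes u :: real and D :: nat
  assumes "3 \<le> u" "2 * u < real D"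
  shows "(\<Prod>i=4..D. \<bar>1 - u\<^sup>2 / (real i)\<^sup>2\<bar>) \<le> 81 / (2 * exp 1 * u ^ 4) * exp (8 * u\<^sup>2 / real D)"
proof -
  define N where "N = nat \<lfloor>u\<rfloor>"
  have N: "3 \<le> N" "real N \<le> u" "u < real N + 1" using assms(1) unfolding N_def by linarith+
  have ND: "2 * N < D" using N assms by linarith
  have "{4..D} = {4..N} \<union> {N+1..D}" using N ND by auto
  then have "(\<Prod>i=4..D. \<bar>1 - u\<^sup>2 / (real i)\<^sup>2\<bar>) = (\<Prod>i=4..N. \<bar>1 - u\<^sup>2 / (real i)\<^sup>2\<bar>) * (\<Prod>i=N+1..D. \<bar>1 - u\<^sup>2 / (real i)\<^sup>2\<bar>)"
    by (simp only:) (rule prod.union_disjoint, auto)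
  also have "\<dots> \<le> (\<Prod>i=4..N. ((real N + 1)\<^sup>2 - (real i)\<^sup>2) / (real i)\<^sup>2)
      * (\<Prod>i=N+1..D. ((real i)\<^sup>2 - (real N)\<^sup>2) / (real i)\<^sup>2)"
  proof (intro mult_mono prod_mono conjI prod_nonneg)
    fix i assume i: "i \<in> {4..N}"
    then have "(real i)\<^sup>2 \<le> u\<^sup>2" "u\<^sup>2 \<le> (real N + 1)\<^sup>2"
      using N by (intro power_mono; simp)+
    moreover have pos: "(real i)\<^sup>2 > 0" using i by simp
    ultimately have "1 \<le> u\<^sup>2 / (real i)\<^sup>2" "u\<^sup>2 / (real i)\<^sup>2 \<le> (real N + 1)\<^sup>2 / (real i)\<^sup>2"
      by (simp, intro divide_right_mono) auto
    moreover have "((real N + 1)\<^sup>2 - (real i)\<^sup>2) / (real i)\<^sup>2 = (real N + 1)\<^sup>2 / (real i)\<^sup>2 - 1"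
      using pos by (simp add: diff_divide_distrib)
    ultimately show "\<bar>1 - u\<^sup>2 / (real i)\<^sup>2\<bar> \<le> ((real N + 1)\<^sup>2 - (real i)\<^sup>2) / (real i)\<^sup>2"
      and "0 \<le> ((real N + 1)\<^sup>2 - (real i)\<^sup>2) / (real i)\<^sup>2" by linarith+
  next
    fix i assume i: "i \<in> {N+1..D}"
    then have "(real N)\<^sup>2 \<le> u\<^sup>2" "u\<^sup>2 \<le> (real i)\<^sup>2"
      using N by (intro power_mono; simp)+
    moreover have pos: "(real i)\<^sup>2 > 0" using i by simp
    ultimately have "u\<^sup>2 / (real i)\<^sup>2 \<le> 1" "(real N)\<^sup>2 / (real i)\<^sup>2 \<le> u\<^sup>2 / (real i)\<^sup>2"
      by (simp, intro divide_right_mono) auto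
    moreover have "((real i)\<^sup>2 - (real N)\<^sup>2) / (real i)\<^sup>2 = 1 - (real N)\<^sup>2 / (real i)\<^sup>2"
      using pos by (simp add: diff_divide_distrib)
    ultimately show "\<bar>1 - u\<^sup>2 / (real i)\<^sup>2\<bar> \<le> ((real i)\<^sup>2 - (real N)\<^sup>2) / (real i)\<^sup>2"
      by linarith
  qed auto
  also have "\<dots> = fact (N - 3) * fact (2 * N + 1) * 36 / (fact (N + 4) * fact (2 * N))
      * (fact (D - N) * fact (D + N) / (fact D)\<^sup>2)"
  proof -
    \<comment> \<open>The literal 1 stands for \<open>fact (N - m)\<close> at
      \<open>m = N\<close>.\<close>
    have alg: "a * b * 36 / (1 * c * n\<^sup>2) * (d * e * n\<^sup>2 / (t * g)) = a * b * 36 / (c * t) * (d * e / g)"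
      if "n \<noteq> 0" for a b c d e g n t :: real using that by simp
    have "(\<Prod>i=4..N. ((real N + 1)\<^sup>2 - (real i)\<^sup>2) / (real i)\<^sup>2)
      = fact (N - 3) * fact (2 * N + 1) * 36 / (1 * fact (N + 4) * (fact N)\<^sup>2)"
      using prod_squares_below[of N N] N(1) by (simp only: diff_self_eq_0 fact_0 mult_2 add_ac le_refl)
    moreover have "(\<Prod>i=N+1..D. ((real i)\<^sup>2 - (real N)\<^sup>2) / (real i)\<^sup>2)
      = fact (D - N) * fact (D + N) * (fact N)\<^sup>2 / (fact (2 * N) * (fact D)\<^sup>2)"
      using ND by (intro prod_squares_above) simp
    ultimately show ?thesis by (simp only: alg[OF fact_nonzero])
  qed
  finally have prod: "(\<Prod>i=4..D. \<bar>1 - u\<^sup>2 / (real i)\<^sup>2\<bar>) \<le> fact (N - 3) * fact (2 * N + 1) * 36 / (fact (N + 4) * fact (2 * N))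
      * (fact (D - N) * fact (D + N) / (fact D)\<^sup>2)" .
  have factor: "fact (N - 3) * fact (2 * N + 1) * 36 / (fact (N + 4) * fact (2 * N)) \<le> 81 / (2 * exp 1 * u ^ 4)"
  proof -
    obtain t where t: "N = t + 3" using N(1) by (metis add.commute le_Suc_ex)
    let ?t = "real t"
    let ?R = "(?t + 7) * (?t + 6) * (?t + 5) * (?t + 4) * (?t + 3) * (?t + 2) * (?t + 1)"
    have "fact (N + 4) = ?R * fact t" unfolding t by (simp add: fact_reduce algebra_simps)
    moreover have "fact (2 * N + 1) = (2 * ?t + 7) * fact (2 * N)"
      unfolding t by (simp only: Suc_eq_plus1[symmetric] fact_Suc) simp
    ultimately have eq: "fact (N - 3) * fact (2 * N + 1) * 36 / (fact (N + 4) * fact (2 * N))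
        = (2 * ?t + 7) * 36 / ?R" unfolding t by simp
    have "(2 * ?t + 7) * 36 * (2 * exp 1 * u ^ 4) \<le> (2 * ?t + 7) * 36 * (2 * 3 * (?t + 4) ^ 4)"
      using N exp_le unfolding t by (intro mult_left_mono mult_mono power_mono) auto
    also have "\<dots> \<le> 81 * ?R"
    proof -
      \<comment> \<open>With \<open>N = t + 3\<close>, the bounds \<open>u < t + 4\<close> and
        \<open>exp 1 \<le> 3\<close> reduce the claim to an inequality between polynomials in
        \<open>t\<close>. After extracting \<open>t + 4\<close>, the difference has only positive
        coefficients.\<close>
      have "81 * ?R - (2 * ?t + 7) * 36 * (2 * 3 * (?t + 4) ^ 4) = (?t + 4) *
         (81 * ?t ^ 6 + 1944 * ?t ^ 5 + 17874 * ?t ^ 4 + 78840 * ?t ^ 3 + 167265 * ?t ^ 2 + 138888 * ?t + 5292)"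
        by (simp add: algebra_simps power_numeral_reduce)
      moreover have "\<dots> \<ge> 0" by (intro mult_nonneg_nonneg add_nonneg_nonneg) auto
      ultimately show ?thesis by linarith
    qed
    finally have "(2 * ?t + 7) * 36 * (2 * exp 1 * u ^ 4) \<le> 81 * ?R" .
    moreover have "?R > 0" by (intro mult_pos_pos) auto
    moreover have "2 * exp 1 * u ^ 4 > 0" using N by (intro mult_pos_pos) auto
    moreover have "A / R \<le> C / E" if "A * E \<le> C * R" "R > 0" "E > 0" for A R C E :: real
      using that by (simp add: field_simps)
    ultimately show ?thesis unfolding eq by blast
  qed
  have "fact (D - N) * fact (D + N) / (fact D)\<^sup>2 \<le> exp (2 * (real N)\<^sup>2 / real D)"
    by (rule central_factorial_quotient_le[OF ND])
  also have "\<dots> \<le> exp (8 * u\<^sup>2 / real D)"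
  proof -
    have "(real N)\<^sup>2 \<le> u\<^sup>2" using N by (intro power_mono) auto
    then have "2 * (real N)\<^sup>2 \<le> 8 * u\<^sup>2" using zero_le_power2[of u] by linarith
    then show ?thesis by (simp add: divide_right_mono)
  qed
  finally have "fact (D - N) * fact (D + N) / (fact D)\<^sup>2 \<le> exp (8 * u\<^sup>2 / real D)" .
  with factor show ?thesis using N by (intro order_trans[OF prod] mult_mono) auto
qed

text \<open>This is a partial product of \<open>sin (pi * u) / (pi * u)\<close> with its first three
  factors removed. The removal gains powers of \<open>1 / u\<close>, and truncation at
  \<open>D\<close> costs only the exponential. The two cases are whether or not \<open>D\<close>
  exceeds \<open>2 * u\<close>.\<close>

lemma prod_squares_le:
  fixes u :: real and D :: nat
  assumes "3 \<le> u" "4 \<le> D"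
  shows "(\<Prod>i=4..D. \<bar>1 - u\<^sup>2 / (real i)\<^sup>2\<bar>) \<le> 81 / (2 * exp 1 * u ^ 4) * exp (8 * u\<^sup>2 / real D)"
  using prod_squares_le_of_large[OF assms] prod_squares_le_of_small[OF assms(1), of D] by linarith

text \<open>
  The zeros are \<open>1, \<dots>, p\<close> and, each \<open>p\<close>-fold, the points \<open>p i\<^sup>2 / 9\<close> for \<open>4 \<le> i \<le> D\<close>. On the scale \<open>j / p\<close> the latter
  are the zeros of \<open>sin (3 \<pi> sqrt x)\<close>; below \<open>p\<close>, where they would be denser than the integers, one simple zero
  at each integer is enough.
\<close>

lemma discrete_chebyshev_bound:
  fixes p D j :: nat
  assumes "1 \<le> p" "4 \<le> D" "p < j"
  shows "(\<Prod>l=1..p. \<bar>1 - real j / real l\<bar>) * (\<Prod>i=4..D. \<bar>1 - 9 * real j / (real p * (real i)\<^sup>2)\<bar>) ^ p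
    \<le> (real p / (2 * real j)) ^ p * exp (72 * real j / real D)"
proof -
  \<comment> \<open>In the variable \<open>u\<close> the \<open>p\<close>-fold zeros
    \<open>p * i^2 / 9\<close> sit at the integers \<open>i\<close>, and \<open>j > p\<close> makes
    \<open>u\<close> at least 3.\<close>
  define u where "u = 3 * sqrt (real j / real p)"
  have pj: "real p > 0" "real j > 0" "real p \<le> real j" "real D > 0" using assms by auto
  have u2: "u\<^sup>2 = 9 * real j / real p" using pj unfolding u_def by (simp add: power_mult_distrib)
  have "sqrt (real j / real p) \<ge> 1" using pj by simp
  then have u: "3 \<le> u" unfolding u_def by linarith
  let ?G = "\<Prod>i=4..D. \<bar>1 - u\<^sup>2 / (real i)\<^sup>2\<bar>"
  have G0: "?G \<ge> 0" by (intro prod_nonneg) auto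
  have "(\<Prod>l=1..p. \<bar>1 - real j / real l\<bar>) \<le> (\<Prod>l=1..p. real j / real l)"
  proof (intro prod_mono conjI)
    fix l assume l: "l \<in> {1..p}"
    then have "real j / real l \<ge> 1" using assms by simp
    then show "\<bar>1 - real j / real l\<bar> \<le> real j / real l" by linarith
  qed simp
  also have "\<dots> = real j ^ p / fact p"
    by (simp add: prod_dividef fact_prod of_nat_prod)
  also have "\<dots> = (real j / real p) ^ p * (real p ^ p / fact p)"
    using pj by (simp add: power_divide)
  also have "\<dots> \<le> (real j / real p) ^ p * exp (real p)"
    using pj self_power_div_fact_le by (intro mult_left_mono) auto
  also have "\<dots> = (u\<^sup>2 / 9 * exp 1) ^ p"
    using exp_of_nat_mult[of p "1::real"] by (simp add: u2 power_mult_distrib power_divide)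
  finally have 1: "(\<Prod>l=1..p. \<bar>1 - real j / real l\<bar>) \<le> (u\<^sup>2 / 9 * exp 1) ^ p" .
  have "(\<Prod>i=4..D. \<bar>1 - 9 * real j / (real p * (real i)\<^sup>2)\<bar>) = ?G"
    by (simp add: u2)
  then have "(\<Prod>l=1..p. \<bar>1 - real j / real l\<bar>) * (\<Prod>i=4..D. \<bar>1 - 9 * real j / (real p * (real i)\<^sup>2)\<bar>) ^ p
     \<le> (u\<^sup>2 / 9 * exp 1) ^ p * ?G ^ p"
    using 1 G0 by (simp add: mult_right_mono)
  also have "\<dots> = (u\<^sup>2 / 9 * exp 1 * ?G) ^ p" by (rule power_mult_distrib[symmetric])
  also have "\<dots> \<le> (u\<^sup>2 / 9 * exp 1 * (81 / (2 * exp 1 * u ^ 4) * exp (8 * u\<^sup>2 / real D))) ^ p"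
    using prod_squares_le[OF u assms(2)] G0 by (intro power_mono mult_left_mono mult_nonneg_nonneg[OF _ G0]) auto
  \<comment> \<open>The constant \<open>81 / (2 * exp 1)\<close> in the bound for the sine product
    was chosen for this cancellation: the simple zeros contribute \<open>exp 1 * u^2 / 9\<close> per
    power, and exactly \<open>p / (2 * j)\<close> is left.\<close>
  also have "u\<^sup>2 / 9 * exp 1 * (81 / (2 * exp 1 * u ^ 4) * exp (8 * u\<^sup>2 / real D))
      = 9 / (2 * u\<^sup>2) * exp (8 * u\<^sup>2 / real D)"
  proof -
    have "v / 9 * exp 1 * (81 / (2 * exp 1 * v\<^sup>2) * X) = 9 / (2 * v) * X" if "v \<noteq> 0" for v X :: real
      using that by (simp add: power2_eq_square)
    moreover have "u ^ 4 = (u\<^sup>2)\<^sup>2" by simp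
    moreover have "u\<^sup>2 \<noteq> 0" using u by simp
    ultimately show ?thesis by metis
  qed
  also have "9 / (2 * u\<^sup>2) = real p / (2 * real j)" using pj by (simp add: u2)
  also have "(real p / (2 * real j) * exp (8 * u\<^sup>2 / real D)) ^ p
     = (real p / (2 * real j)) ^ p * exp (real p * (8 * u\<^sup>2 / real D))"
    by (simp only: power_mult_distrib exp_of_nat_mult[of p])
  also have "real p * (8 * u\<^sup>2 / real D) = 72 * real j / real D" using pj by (simp add: u2)
  finally show ?thesis .
qed

lemma sum_inverse_squares_le:
  assumes "1 \<le> p" "p \<le> n"
  shows "(\<Sum>j=p+1..n. 1 / (real j)\<^sup>2) \<le> 1 / real p - 1 / real n"
  using assms(2)
proof (induction n rule: dec_induct)
  case base
  show ?case by simp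
next
  case (step n)
  have n: "real n > 0" using assms(1) step.hyps by simp
  have "1 / (real (Suc n))\<^sup>2 \<le> 1 / (real n * real (Suc n))"
    using n by (intro divide_left_mono) (auto simp: power2_eq_square intro!: mult_right_mono)
  also have "\<dots> = 1 / real n - 1 / real (Suc n)" using n by (simp add: field_simps)
  finally show ?case using step by simp
qed

text \<open>For \<open>j > p \<ge> 2\<close> the power \<open>(p / j) ^ p\<close> is at most
  \<open>(p / j) ^ 2\<close>, which is summable with total at most \<open>p\<close>; the factor
  \<open>2 ^ (-p)\<close> comes out in front. This factor is what later beats the coefficient bound
  \<open>M\<close>.\<close>

lemma sum_half_powers_le:
  fixes p n :: nat
  assumes "2 \<le> p"
  shows "(\<Sum>j=p+1..n. (real p / (2 * real j)) ^ p) \<le> real p / 2 ^ p"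
proof (cases "p \<le> n")
  case True
  have "(\<Sum>j=p+1..n. (real p / (2 * real j)) ^ p) \<le> (\<Sum>j=p+1..n. (real p)\<^sup>2 / 2 ^ p * (1 / (real j)\<^sup>2))"
  proof (rule sum_mono)
    fix j assume j: "j \<in> {p+1..n}"
    have "(real p / (2 * real j)) ^ p = (real p / real j) ^ p / 2 ^ p"
      by (simp add: power_divide power_mult_distrib)
    also have "(real p / real j) ^ p \<le> (real p / real j)\<^sup>2"
      using j assms by (intro power_decreasing) auto
    finally show "(real p / (2 * real j)) ^ p \<le> (real p)\<^sup>2 / 2 ^ p * (1 / (real j)\<^sup>2)"
      by (simp add: divide_right_mono power_divide mult.commute)
  qed
  also have "\<dots> = (real p)\<^sup>2 / 2 ^ p * (\<Sum>j=p+1..n. 1 / (real j)\<^sup>2)"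
    by (simp only: sum_distrib_left)
  also have "\<dots> \<le> (real p)\<^sup>2 / 2 ^ p * (1 / real p)"
  proof (intro mult_left_mono)
    show "(\<Sum>j=p+1..n. 1 / (real j)\<^sup>2) \<le> 1 / real p"
      using sum_inverse_squares_le[of p n] assms True by (simp add: order_trans)
  qed simp
  also have "\<dots> = real p / 2 ^ p" using assms by (simp add: power2_eq_square)
  finally show ?thesis .
qed simp

section \<open>Polynomials cannot be small at all nodes\<close>

text \<open>The sum of the absolute values of the coefficients is submultiplicative. The lemma is
  used twice: for the weights that isolate the lowest coefficient, and for the polynomial that
  carries a sign pattern.\<close>

lemma prod_linear_expand:
  fixes A B :: "'i \<Rightarrow> real"
  assumes "finite Z"
  shows "\<exists>w. (\<forall>x. (\<Prod>z\<in>Z. A z * x + B z) = (\<Sum>i\<le>card Z. w i * x ^ i)) \<and>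
    (\<Sum>i\<le>card Z. \<bar>w i\<bar>) \<le> (\<Prod>z\<in>Z. \<bar>A z\<bar> + \<bar>B z\<bar>)"
  using assms
proof (induction Z)
  case empty
  show ?case by (rule exI[of _ "\<lambda>_. 1"]) simp
next
  case (insert z Z)
  then obtain w where w: "\<And>x. (\<Prod>z\<in>Z. A z * x + B z) = (\<Sum>i\<le>card Z. w i * x ^ i)"
    and n: "(\<Sum>i\<le>card Z. \<bar>w i\<bar>) \<le> (\<Prod>z\<in>Z. \<bar>A z\<bar> + \<bar>B z\<bar>)" by auto
  \<comment> \<open>\<open>?u\<close> is the coefficient sequence shifted by one place, for
    multiplication by \<open>x\<close>; \<open>?v\<close> is the old sequence padded with a zero at
    the top.\<close>
  let ?u = "\<lambda>i. if i = 0 then 0 else w (i - 1)" and ?v = "\<lambda>i. if i \<le> card Z then w i else 0"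
  have u: "(\<Sum>i\<le>Suc (card Z). g i (?u i)) = g 0 0 + (\<Sum>i\<le>card Z. g (Suc i) (w i))"
    for g :: "nat \<Rightarrow> real \<Rightarrow> real"
    by (subst sum.atMost_Suc_shift) simp
  have v: "(\<Sum>i\<le>Suc (card Z). g i (?v i)) = (\<Sum>i\<le>card Z. g i (w i)) + g (Suc (card Z)) 0"
    for g :: "nat \<Rightarrow> real \<Rightarrow> real" by simp
  let ?w = "\<lambda>i. A z * ?u i + B z * ?v i"
  have "(\<Prod>z\<in>insert z Z. A z * x + B z) = (\<Sum>i\<le>card (insert z Z). ?w i * x ^ i)" for x
  proof -
    have "(\<Sum>i\<le>card (insert z Z). ?w i * x ^ i)
      = A z * (\<Sum>i\<le>Suc (card Z). ?u i * x ^ i) + B z * (\<Sum>i\<le>Suc (card Z). ?v i * x ^ i)"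
      unfolding sum_distrib_left sum.distrib[symmetric]
      using insert.hyps by (intro sum.cong) (auto simp: algebra_simps)
    also have "\<dots> = A z * (\<Sum>i\<le>card Z. w i * x ^ Suc i) + B z * (\<Sum>i\<le>card Z. w i * x ^ i)"
      using u[of "\<lambda>i y. y * x ^ i"] v[of "\<lambda>i y. y * x ^ i"] by simp
    also have "\<dots> = (A z * x + B z) * (\<Sum>i\<le>card Z. w i * x ^ i)"
      by (simp only: distrib_right) (simp add: sum_distrib_left mult_ac)
    finally show ?thesis using insert.hyps w by simp
  qed
  moreover have "(\<Sum>i\<le>card (insert z Z). \<bar>?w i\<bar>) \<le> (\<Prod>z\<in>insert z Z. \<bar>A z\<bar> + \<bar>B z\<bar>)"
  proof -
    have "(\<Sum>i\<le>card (insert z Z). \<bar>?w i\<bar>)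
      \<le> (\<Sum>i\<le>Suc (card Z). \<bar>A z\<bar> * \<bar>?u i\<bar> + \<bar>B z\<bar> * \<bar>?v i\<bar>)"
    proof -
      have "card (insert z Z) = Suc (card Z)" using insert.hyps by simp
      then show ?thesis
        by (simp only:) (intro sum_mono, simp only: abs_mult[symmetric] abs_triangle_ineq)
    qed
    also have "\<dots> = \<bar>A z\<bar> * (\<Sum>i\<le>Suc (card Z). \<bar>?u i\<bar>) + \<bar>B z\<bar> * (\<Sum>i\<le>Suc (card Z). \<bar>?v i\<bar>)"
      by (simp only: sum.distrib sum_distrib_left)
    also have "\<dots> = (\<bar>A z\<bar> + \<bar>B z\<bar>) * (\<Sum>i\<le>card Z. \<bar>w i\<bar>)"
      using u[of "\<lambda>i y. \<bar>y\<bar>"] v[of "\<lambda>i y. \<bar>y\<bar>"] by (simp add: algebra_simps)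
    also have "\<dots> \<le> (\<bar>A z\<bar> + \<bar>B z\<bar>) * (\<Prod>z\<in>Z. \<bar>A z\<bar> + \<bar>B z\<bar>)"
      using n by (intro mult_left_mono) auto
    finally show ?thesis using insert.hyps by simp
  qed
  ultimately show ?case by (intro exI[of _ ?w]) simp
qed

text \<open>
  By convexity of \<open>exp\<close>, a factor of a polynomial in \<open>exp (- h x)\<close>, normalised at \<open>x = 0\<close>, is dominated by the
  corresponding linear factor in \<open>x\<close>.
\<close>

lemma exp_ratio_le:
  fixes h l x :: real
  assumes "h > 0" "l > 0" "x \<ge> 0"
  shows "\<bar>exp (- h * x) - exp (- h * l)\<bar> / (1 - exp (- h * l)) \<le> \<bar>1 - x / l\<bar>"
proof -
  have pos: "1 - exp (- h * l) > 0" using assms by simp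
  show ?thesis
  proof (cases "x \<le> l")
    case True
    have "exp ((1 - x / l) *\<^sub>R 0 + (x / l) *\<^sub>R (- h * l)) \<le> (1 - x / l) * exp 0 + (x / l) * exp (- h * l)"
      by (rule convex_onD[OF exp_convex]) (use assms True in auto)
    then have "exp (- h * x) - exp (- h * l) \<le> (1 - x / l) * (1 - exp (- h * l))"
      using assms by (simp add: algebra_simps)
    moreover have "exp (- h * l) \<le> exp (- h * x)" using True assms by simp
    moreover have "x / l \<le> 1" using True assms by simp
    ultimately show ?thesis using pos by (simp add: divide_le_eq)
  next
    case False
    have e: "exp (h * l) * exp (- h * l) = 1" "exp (h * l) * exp (- h * x) = exp (- (h * (x - l)))"
      by (simp_all add: exp_add[symmetric] algebra_simps)
    have e1: "1 - exp (- (h * (x - l))) \<le> h * (x - l)"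
      using exp_ge_add_one_self[of "- (h * (x - l))"] by simp
    have e2: "h * l \<le> exp (h * l) - 1" using exp_ge_add_one_self[of "h * l"] by linarith
    have "exp (- h * l) - exp (- h * x) = exp (- h * l) * (1 - exp (- (h * (x - l))))"
      by (simp add: algebra_simps exp_add[symmetric])
    also have "\<dots> \<le> exp (- h * l) * ((x / l - 1) * (h * l))"
    proof -
      have "(x / l - 1) * (h * l) = h * (x - l)" using assms by (simp add: field_simps)
      then show ?thesis using e1 by (simp only: mult_le_cancel_left_pos exp_gt_zero)
    qed
    also have "\<dots> \<le> exp (- h * l) * ((x / l - 1) * (exp (h * l) - 1))"
      using e2 assms False by (intro mult_left_mono) (auto simp: field_simps)
    also have "\<dots> = (x / l - 1) * (1 - exp (- h * l))"
      using e(1) by (simp add: algebra_simps)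
    finally have *: "exp (- h * l) - exp (- h * x) \<le> (x / l - 1) * (1 - exp (- h * l))" .
    moreover have "exp (- h * x) \<le> exp (- h * l)" using False assms by simp
    moreover have "x / l \<ge> 1" using False assms by simp
    ultimately show ?thesis using pos by (simp add: divide_le_eq)
  qed
qed

text \<open>Let \<open>W\<close> have the zeros \<open>exp (- h * l z)\<close> and the value 1 at 1.
  Weighting the node values with the coefficients of \<open>W\<close> gives \<open>c 0\<close> plus
  terms \<open>c j * exp (- \<tau> * j) * W (exp (- h * j))\<close>, which total at most 1/2 by
  \<open>small\<close>. The weights have absolute sum at most \<open>S\<close>, so some node value
  is at least \<open>1 / (2 * S)\<close>. Indexing zeros by \<open>Z\<close>, with \<open>l\<close>
  not assumed injective, allows multiplicities.\<close>

lemma exists_large_node_value: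
  fixes c :: "nat \<Rightarrow> real" and l :: "'i \<Rightarrow> real" and h \<tau> M S :: real and n :: nat
  assumes fin: "finite Z" and l: "\<And>z. z \<in> Z \<Longrightarrow> l z > 0" and h: "h > 0"
    and c0: "\<bar>c 0\<bar> \<ge> 1" and cM: "\<And>j. j \<le> n \<Longrightarrow> \<bar>c j\<bar> \<le> M" and M: "M > 0"
    and small: "(\<Sum>j=1..n. exp (- \<tau> * real j) * (\<Prod>z\<in>Z. \<bar>1 - real j / l z\<bar>)) \<le> 1 / (2 * M)"
    and S: "(\<Prod>z\<in>Z. 2 / (1 - exp (- h * l z))) \<le> S"
  shows "\<exists>i\<le>card Z. \<bar>\<Sum>j\<le>n. c j * exp (- (\<tau> + real i * h)) ^ j\<bar> \<ge> 1 / (2 * S)"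
proof -
  let ?f = "\<lambda>i. \<bar>\<Sum>j\<le>n. c j * exp (- (\<tau> + real i * h)) ^ j\<bar>"
  define F where "F = Max (?f ` {..card Z})"
  have "F \<in> ?f ` {..card Z}" unfolding F_def by (rule Max_in) auto
  then obtain k where k: "k \<le> card Z" "F = ?f k" by auto
  have F: "?f i \<le> F" if "i \<le> card Z" for i
    unfolding F_def using that by (intro Max_ge) auto
  define d where "d z = 1 - exp (- h * l z)" for z
  have d: "d z > 0" if "z \<in> Z" for z unfolding d_def using l[OF that] h by simp
  define A where "A z = 1 / d z" for z
  define B where "B z = - exp (- h * l z) / d z" for z
  obtain w where w: "\<And>x. (\<Prod>z\<in>Z. A z * x + B z) = (\<Sum>i\<le>card Z. w i * x ^ i)"
    and wS: "(\<Sum>i\<le>card Z. \<bar>w i\<bar>) \<le> (\<Prod>z\<in>Z. \<bar>A z\<bar> + \<bar>B z\<bar>)"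
    using prod_linear_expand[OF fin, of A B] by blast
  have lin: "A z * x + B z = (x - exp (- h * l z)) / d z" for x z
    by (simp add: A_def B_def diff_divide_distrib)
  have "(\<Prod>z\<in>Z. \<bar>A z\<bar> + \<bar>B z\<bar>) \<le> (\<Prod>z\<in>Z. 2 / d z)"
  proof (intro prod_mono conjI)
    fix z assume z: "z \<in> Z"
    have "\<bar>A z\<bar> + \<bar>B z\<bar> = (1 + exp (- h * l z)) / d z"
      using d[OF z] by (simp add: A_def B_def add_divide_distrib)
    also have "\<dots> \<le> 2 / d z" using d[OF z] mult_pos_pos[OF h l[OF z]] by (intro divide_right_mono) simp_all
    finally show "\<bar>A z\<bar> + \<bar>B z\<bar> \<le> 2 / d z" .
  qed simp
  then have wS: "(\<Sum>i\<le>card Z. \<bar>w i\<bar>) \<le> S" using wS S unfolding d_def by linarith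
  have S0: "S > 0"
  proof -
    have "(\<Prod>z\<in>Z. 2 / d z) > 0" using d by (intro prod_pos) auto
    then show ?thesis using S unfolding d_def by linarith
  qed
  define W where "W x = (\<Prod>z\<in>Z. A z * x + B z)" for x
  have "W 1 = 1"
  proof -
    have "A z * 1 + B z = 1" if "z \<in> Z" for z using d[OF that] l[OF that] h by (simp only: lin) (simp add: d_def)
    then show ?thesis unfolding W_def by (simp del: mult_1_right)
  qed
  have Wj: "\<bar>W (exp (- h * real j))\<bar> \<le> (\<Prod>z\<in>Z. \<bar>1 - real j / l z\<bar>)" for j
    unfolding W_def abs_prod lin
  proof (intro prod_mono conjI)
    fix z assume z: "z \<in> Z"
    show "\<bar>(exp (- h * real j) - exp (- h * l z)) / d z\<bar> \<le> \<bar>1 - real j / l z\<bar>"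
      using exp_ratio_le[OF h l[OF z], of "real j"] d[OF z] unfolding d_def by simp
  qed simp
  let ?E = "\<lambda>j. c j * exp (- \<tau> * real j) * W (exp (- h * real j))"
  have node: "exp (- (\<tau> + real i * h)) ^ j = exp (- \<tau> * real j) * exp (- h * real j) ^ i" for i j
    by (simp only: exp_of_nat_mult[symmetric] exp_add[symmetric]) (simp add: algebra_simps)
  have "(\<Sum>i\<le>card Z. w i * (\<Sum>j\<le>n. c j * exp (- (\<tau> + real i * h)) ^ j))
     = (\<Sum>j\<le>n. c j * exp (- \<tau> * real j) * (\<Sum>i\<le>card Z. w i * exp (- h * real j) ^ i))"
    unfolding node sum_distrib_left
    by (subst sum.swap) (intro sum.cong refl, simp only: mult_ac)
  also have "\<dots> = (\<Sum>j\<le>n. ?E j)" unfolding W_def w ..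
  also have "\<dots> = c 0 + (\<Sum>j=1..n. ?E j)"
    using \<open>W 1 = 1\<close> by (simp add: sum.atLeast0_atMost_Suc_shift atMost_atLeast0 sum.atLeast_Suc_atMost)
  finally have eq: "(\<Sum>i\<le>card Z. w i * (\<Sum>j\<le>n. c j * exp (- (\<tau> + real i * h)) ^ j)) = c 0 + (\<Sum>j=1..n. ?E j)" .
  have "\<bar>\<Sum>j=1..n. ?E j\<bar> \<le> (\<Sum>j=1..n. M * (exp (- \<tau> * real j) * (\<Prod>z\<in>Z. \<bar>1 - real j / l z\<bar>)))"
  proof (rule order_trans[OF sum_abs sum_mono])
    fix j assume "j \<in> {1..n}"
    then have "\<bar>c j\<bar> * (exp (- \<tau> * real j) * \<bar>W (exp (- h * real j))\<bar>)
      \<le> M * (exp (- \<tau> * real j) * (\<Prod>z\<in>Z. \<bar>1 - real j / l z\<bar>))"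
      using cM[of j] Wj[of j] M by (intro mult_mono) auto
    then show "\<bar>?E j\<bar> \<le> M * (exp (- \<tau> * real j) * (\<Prod>z\<in>Z. \<bar>1 - real j / l z\<bar>))"
      by (simp add: abs_mult mult.assoc)
  qed
  also have "\<dots> = M * (\<Sum>j=1..n. exp (- \<tau> * real j) * (\<Prod>z\<in>Z. \<bar>1 - real j / l z\<bar>))"
    by (simp only: sum_distrib_left)
  also have "\<dots> \<le> M * (1 / (2 * M))" using small M by (intro mult_left_mono) auto
  finally have "\<bar>\<Sum>j=1..n. ?E j\<bar> \<le> 1 / 2" using M by simp
  then have "1 / 2 \<le> \<bar>\<Sum>i\<le>card Z. w i * (\<Sum>j\<le>n. c j * exp (- (\<tau> + real i * h)) ^ j)\<bar>"
    unfolding eq using c0 by linarith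
  also have "\<dots> \<le> (\<Sum>i\<le>card Z. \<bar>w i\<bar> * \<bar>\<Sum>j\<le>n. c j * exp (- (\<tau> + real i * h)) ^ j\<bar>)"
    using sum_abs by (simp flip: abs_mult)
  also have "\<dots> \<le> (\<Sum>i\<le>card Z. \<bar>w i\<bar> * F)"
    using F by (intro sum_mono mult_left_mono) auto
  also have "\<dots> = (\<Sum>i\<le>card Z. \<bar>w i\<bar>) * F" by (simp only: sum_distrib_right)
  also have "\<dots> \<le> S * F" using wS k by (intro mult_right_mono) auto
  finally have "1 / (2 * S) \<le> F" using S0 by (simp add: field_simps)
  then show ?thesis using k by blast
qed

section \<open>Choice of the zeros and the resulting lower bound at a node\<close>

lemma half_le_one_minus_exp_minus:
  fixes x :: real
  assumes "0 \<le> x" "x \<le> 1"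
  shows "x / 2 \<le> 1 - exp (- x)"
proof -
  have "exp (- x) \<le> 1 / (1 + x)"
    using exp_ge_add_one_self[of x] assms by (simp add: exp_minus inverse_eq_divide frac_le)
  also have "1 / (1 + x) \<le> 1 - x / 2"
    using assms mult_mono[of x 1 x x] by (simp add: field_simps)
  finally show ?thesis by simp
qed

text \<open>With \<open>p \<ge> 4 * L\<close>, \<open>2 * M\<close> is at most
  \<open>exp (p / 4) / 2\<close>, and \<open>p\<close> is at most \<open>2 * exp (p / 3)\<close>.
  The exponents add up to \<open>7/12 * p\<close>, and 7/12 is below \<open>ln 2\<close>.\<close>

lemma double_times_le_two_power:
  fixes L M :: real
  assumes M: "4 * M = exp L" and L: "L \<ge> 0" and p: "4 * L \<le> real p"
  shows "2 * M * real p \<le> 2 ^ p"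
proof -
  let ?p = "real p"
  have e2: "(2::real) \<le> exp 1" using exp_ge_add_one_self[of 1] by simp
  have "?p / 3 \<le> exp (?p / 3 - 1)" using exp_ge_add_one_self[of "?p / 3 - 1"] by simp
  also have "\<dots> = exp (?p / 3) / exp 1" by (simp add: exp_diff)
  also have "\<dots> \<le> exp (?p / 3) / 2" using e2 by (intro divide_left_mono) auto
  finally have 1: "?p \<le> 2 * exp (?p / 3)" using exp_gt_zero[of "?p / 3"] by linarith
  have 2: "2 * M \<le> exp (?p / 4) / 2" using M p by simp
  have "2 * M * ?p \<le> exp (?p / 4) / 2 * (2 * exp (?p / 3))" using 1 2 by (intro mult_mono) auto
  also have "\<dots> = exp (?p * (7/12))" by (simp add: exp_add[symmetric])
  also have "\<dots> \<le> exp (?p * ln 2)"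
    unfolding exp_le_cancel_iff using ln2_ge_two_thirds by (intro mult_left_mono) auto
  also have "\<dots> = 2 ^ p" by (simp add: exp_of_nat_mult)
  finally show ?thesis .
qed

text \<open>The step \<open>h\<close> is so small that \<open>h * x \<le> 1\<close> at every zero
  \<open>x\<close>, hence each factor is at most \<open>4 / (h * x)\<close>. The products of
  \<open>1 / l\<close> and of \<open>1 / i^2\<close> supply factorials that absorb the powers
  \<open>p ^ p\<close> and \<open>D ^ (2 * D)\<close>, so the total is \<open>exp\<close> of a
  constant times \<open>p * D\<close>, without a logarithmic factor.\<close>

lemma prod_factors_le:
  fixes \<alpha> :: real and p D :: nat
  assumes \<alpha>: "0 < \<alpha>" "48 / \<alpha> \<le> real D" "real D \<le> 49 / \<alpha>" and p: "p \<ge> 1" and D: "D \<ge> 4"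
  defines "h \<equiv> \<alpha> / (8 * real p * real D)"
  shows "(\<Prod>l=1..p. 2 / (1 - exp (- h * real l))) * (\<Prod>i=4..D. 2 / (1 - exp (- h * (real p * (real i)\<^sup>2 / 9)))) ^ p
    \<le> exp (7 * real p * real D)"
proof -
  have pD: "real p > 0" "real D > 0" "h > 0" using p D \<alpha> by (auto simp: h_def)
  have aD: "\<alpha> * real D \<le> 49" "48 \<le> \<alpha> * real D" using \<alpha> by (simp_all add: field_simps)
  have factor: "2 / (1 - exp (- h * x)) \<le> 4 / (h * x)" if "0 < x" "h * x \<le> 1" for x
  proof -
    have "h * x / 2 \<le> 1 - exp (- (h * x))"
      using that pD by (intro half_le_one_minus_exp_minus) auto
    then have "2 / (1 - exp (- h * x)) \<le> 2 / (h * x / 2)"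
      using that pD by (intro divide_left_mono mult_pos_pos) auto
    then show ?thesis by simp
  qed
  have nn: "0 \<le> 2 / (1 - exp (- h * x))" if "0 < x" for x using that pD by simp
  have ia: "1 / \<alpha> \<le> real D / 48" using \<alpha> by simp
  have first: "(\<Prod>l=1..p. 2 / (1 - exp (- h * real l))) \<le> exp (real p + 2 * real p * real D)"
  proof -
    have "(\<Prod>l=1..p. 2 / (1 - exp (- h * real l))) \<le> (\<Prod>l=1..p. real p * (real D)\<^sup>2 / real l)"
    proof (intro prod_mono conjI nn)
      fix l assume l: "l \<in> {1..p}"
      then show "0 < real l" by simp
      have "h * real l \<le> h * real p" using l pD by simp
      also have "\<dots> = \<alpha> / (8 * real D)" using pD by (simp add: h_def)
      also have "\<dots> \<le> 1"
      proof -
        have "\<alpha> * 4 \<le> \<alpha> * real D" using D \<alpha>(1) by (intro mult_left_mono) auto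
        then have "\<alpha> \<le> 8 * real D" using aD D by linarith
        then show ?thesis using pD by simp
      qed
      finally have "2 / (1 - exp (- h * real l)) \<le> 4 / (h * real l)" using l by (intro factor) auto
      also have "\<dots> = 32 * real p * real D / real l * (1 / \<alpha>)" using pD \<alpha> l by (simp add: h_def field_simps)
      also have "\<dots> \<le> 32 * real p * real D / real l * (real D / 48)" using ia by (intro mult_left_mono) auto
      also have "\<dots> \<le> real p * (real D)\<^sup>2 / real l"
        using pD l by (simp add: field_simps power2_eq_square)
      finally show "2 / (1 - exp (- h * real l)) \<le> real p * (real D)\<^sup>2 / real l" .
    qed
    also have "\<dots> = real p ^ p / fact p * ((real D)\<^sup>2) ^ p"
      by (simp add: prod_dividef fact_prod power_mult_distrib of_nat_prod)
    also have "\<dots> \<le> exp (real p) * (exp (2 * real D)) ^ p"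
    proof (intro mult_mono power_mono self_power_div_fact_le)
      have "(real D)\<^sup>2 \<le> (exp (real D))\<^sup>2"
        using exp_ge_add_one_self[of "real D"] by (intro power_mono) linarith+
      then show "(real D)\<^sup>2 \<le> exp (2 * real D)" by (simp add: exp_double)
    qed auto
    also have "\<dots> = exp (real p + 2 * real p * real D)"
      by (simp only: exp_of_nat_mult[symmetric] exp_add[symmetric]) (simp add: algebra_simps)
    finally show ?thesis .
  qed
  have second: "(\<Prod>i=4..D. 2 / (1 - exp (- h * (real p * (real i)\<^sup>2 / 9)))) \<le> exp (4 * real D)"
  proof -
    have "(\<Prod>i=4..D. 2 / (1 - exp (- h * (real p * (real i)\<^sup>2 / 9)))) \<le> (\<Prod>i=4..D. 6 * (real D)\<^sup>2 / (real i)\<^sup>2)"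
    proof (intro prod_mono conjI nn)
      fix i assume i: "i \<in> {4..D}"
      then have i0: "real i > 0" by simp
      show pos: "0 < real p * (real i)\<^sup>2 / 9" using i0 pD by simp
      have "(real i)\<^sup>2 \<le> (real D)\<^sup>2" using i by (intro power_mono) auto
      then have "h * (real p * (real i)\<^sup>2 / 9) \<le> h * (real p * (real D)\<^sup>2 / 9)"
        using pD by (intro mult_left_mono divide_right_mono) auto
      also have "\<dots> = \<alpha> * real D / 72" using pD by (simp add: h_def power2_eq_square)
      also have "\<dots> \<le> 1" using aD by simp
      finally have "2 / (1 - exp (- h * (real p * (real i)\<^sup>2 / 9))) \<le> 4 / (h * (real p * (real i)\<^sup>2 / 9))"
        using pos by (intro factor)
      also have "\<dots> = 288 * real D / (real i)\<^sup>2 * (1 / \<alpha>)" using pD \<alpha> i0 by (simp add: h_def)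
      also have "\<dots> \<le> 288 * real D / (real i)\<^sup>2 * (real D / 48)" using ia by (intro mult_left_mono) auto
      also have "\<dots> = 6 * (real D)\<^sup>2 / (real i)\<^sup>2" by (simp add: power2_eq_square)
      finally show "2 / (1 - exp (- h * (real p * (real i)\<^sup>2 / 9))) \<le> 6 * (real D)\<^sup>2 / (real i)\<^sup>2" .
    qed
    \<comment> \<open>The three factors added here are at least 1; they complete the denominator to
      the square of \<open>fact D\<close>.\<close>
    also have "\<dots> \<le> (\<Prod>i=1..D. 6 * (real D)\<^sup>2 / (real i)\<^sup>2)"
    proof (intro prod_mono2)
      fix i assume "i \<in> {1..D} - {4..D}"
      then have "(real i)\<^sup>2 \<le> (real D)\<^sup>2" "(real i)\<^sup>2 > 0" by (auto intro!: power_mono)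
      then have "(real i)\<^sup>2 \<le> 6 * (real D)\<^sup>2" by linarith
      then show "1 \<le> 6 * (real D)\<^sup>2 / (real i)\<^sup>2" using \<open>(real i)\<^sup>2 > 0\<close> by simp
    qed auto
    also have "\<dots> = 6 ^ D * (real D ^ D / fact D)\<^sup>2"
      by (simp add: prod_dividef fact_prod of_nat_prod power_mult_distrib power_divide prod_power_distrib
          power_mult[symmetric] mult.commute)
    also have "\<dots> \<le> (exp 2) ^ D * (exp (real D))\<^sup>2"
    proof (intro mult_mono power_mono self_power_div_fact_le)
      have "(6::real) \<le> (5/2)\<^sup>2" by (simp add: power2_eq_square)
      also have "\<dots> \<le> (exp 1)\<^sup>2" 
        using exp_lower_Taylor_quadratic[of 1] by (intro power_mono) auto
      finally show "(6::real) \<le> exp 2" by (simp flip: exp_double)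
    qed auto
    also have "\<dots> = exp (4 * real D)"
      by (simp only: exp_of_nat_mult[symmetric] exp_double[symmetric] exp_add[symmetric]) simp
    finally show ?thesis .
  qed
  have "(\<Prod>l=1..p. 2 / (1 - exp (- h * real l))) * (\<Prod>i=4..D. 2 / (1 - exp (- h * (real p * (real i)\<^sup>2 / 9)))) ^ p
     \<le> exp (real p + 2 * real p * real D) * exp (4 * real D) ^ p"
    using pD by (intro mult_mono first power_mono second zero_le_power prod_nonneg nn) auto
  also have "\<dots> = exp (real p + 6 * real p * real D)"
    by (simp only: exp_of_nat_mult[symmetric] exp_add[symmetric]) (simp add: algebra_simps)
  also have "\<dots> \<le> exp (7 * real p * real D)" 
    using pD D mult_left_mono[of 1 "real D" "real p"] by simp
  finally show ?thesis .
qed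

text \<open>The indices \<open>1..p\<close> are zeros of the isolating polynomial and drop out. For
  \<open>j > p\<close> its growth is at most \<open>exp (72 * j / D)\<close>, and
  \<open>D \<ge> 48 / \<alpha>\<close> makes the damping \<open>exp (- 3 * \<alpha> / 2 * j)\<close>
  of the first node cancel it. The remaining tail is at most \<open>p / 2 ^ p\<close>, hence at most
  \<open>1 / (2 * M)\<close>.\<close>

lemma polynomial_large_at_node:
  fixes c :: "nat \<Rightarrow> real" and \<alpha> L M :: real and n p D :: nat
  assumes \<alpha>: "0 < \<alpha>" "48 / \<alpha> \<le> real D" "real D \<le> 49 / \<alpha>" and D: "D \<ge> 4"
    and M: "4 * M = exp L" and L: "L \<ge> 1" and p: "4 * L \<le> real p"
    and c: "\<bar>c 0\<bar> \<ge> 1" "\<And>j. j \<le> n \<Longrightarrow> \<bar>c j\<bar> \<le> M"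
  defines "h \<equiv> \<alpha> / (8 * real p * real D)"
  shows "\<exists>i\<le>p * (D - 2). \<bar>\<Sum>j\<le>n. c j * exp (- (3 * \<alpha> / 2 + real i * h)) ^ j\<bar> \<ge> 1 / (2 * exp (7 * real p * real D))"
proof -
  \<comment> \<open>Pairs \<open>(a, 0)\<close> index the simple zeros \<open>a\<close>; pairs
    \<open>(i, b)\<close> with \<open>b\<close> from 1 to \<open>p\<close> index the
    \<open>p\<close> copies of the zero \<open>p * i^2 / 9\<close>. Together there are
    \<open>p + p * (D - 3)\<close> of them.\<close>
  define Z where "Z = {1..p} \<times> {0::nat} \<union> {4..D} \<times> {1..p}"
  define l where "l = (\<lambda>(a, b::nat). if b = 0 then real a else real p * (real a)\<^sup>2 / 9)"
  have p4: "p \<ge> 4" using L p by linarith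
  have pD: "real p > 0" "real D > 0" "h > 0" using p4 D \<alpha> by (auto simp: h_def)
  have M0: "M > 0" using M exp_gt_zero[of L] by linarith
  have fin: "finite Z" unfolding Z_def by simp
  have "card Z = card ({1..p} \<times> {0::nat}) + card ({4..D} \<times> {1..p})"
    unfolding Z_def by (rule card_Un_disjoint) auto
  also have "\<dots> = p * (D - 2)" using D by (simp add: card_cartesian_product algebra_simps diff_mult_distrib2)
  finally have card: "card Z = p * (D - 2)" .
  have prodZ: "(\<Prod>z\<in>Z. G (l z)) = (\<Prod>a=1..p. G (real a)) * (\<Prod>i=4..D. G (real p * (real i)\<^sup>2 / 9)) ^ p"
    for G :: "real \<Rightarrow> real"
  proof -
    have "(\<Prod>z\<in>Z. G (l z)) = (\<Prod>z\<in>{1..p} \<times> {0}. G (l z)) * (\<Prod>z\<in>{4..D} \<times> {1..p}. G (l z))"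
      unfolding Z_def by (rule prod.union_disjoint) auto
    also have "(\<Prod>z\<in>{1..p} \<times> {0}. G (l z)) = (\<Prod>a=1..p. \<Prod>b\<in>{0}. G (l (a, b)))"
      unfolding prod.cartesian_product by (simp add: case_prod_unfold)
    also have "\<dots> = (\<Prod>a=1..p. G (real a))" by (simp add: l_def)
    also have "(\<Prod>z\<in>{4..D} \<times> {1..p}. G (l z)) = (\<Prod>i=4..D. \<Prod>b=1..p. G (l (i, b)))"
      unfolding prod.cartesian_product by (simp add: case_prod_unfold)
    also have "\<dots> = (\<Prod>i=4..D. G (real p * (real i)\<^sup>2 / 9) ^ p)"
      by (intro prod.cong refl) (simp add: l_def)
    finally show ?thesis by (simp add: prod_power_distrib)
  qed
  have "\<exists>i\<le>card Z. \<bar>\<Sum>j\<le>n. c j * exp (- (3 * \<alpha> / 2 + real i * h)) ^ j\<bar> \<ge> 1 / (2 * exp (7 * real p * real D))"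
  proof (rule exists_large_node_value[where l = l and M = M])
    show "l z > 0" if "z \<in> Z" for z using that pD by (auto simp: Z_def l_def)
    show "(\<Prod>z\<in>Z. 2 / (1 - exp (- h * l z))) \<le> exp (7 * real p * real D)"
      unfolding prodZ[of "\<lambda>x. 2 / (1 - exp (- h * x))"] unfolding h_def
      using p4 by (intro prod_factors_le \<alpha> D) auto
    show "(\<Sum>j=1..n. exp (- (3 * \<alpha> / 2) * real j) * (\<Prod>z\<in>Z. \<bar>1 - real j / l z\<bar>)) \<le> 1 / (2 * M)"
    proof -
      have "(\<Sum>j=1..n. exp (- (3 * \<alpha> / 2) * real j) * (\<Prod>z\<in>Z. \<bar>1 - real j / l z\<bar>))
        \<le> (\<Sum>j=1..n. if p < j then (real p / (2 * real j)) ^ p else 0)"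
      proof (rule sum_mono)
        fix j assume j: "j \<in> {1..n}"
        show "exp (- (3 * \<alpha> / 2) * real j) * (\<Prod>z\<in>Z. \<bar>1 - real j / l z\<bar>)
           \<le> (if p < j then (real p / (2 * real j)) ^ p else 0)"
        proof (cases "p < j")
          case False
          then have "(\<Prod>a=1..p. \<bar>1 - real j / real a\<bar>) = 0" using j by (intro prod_zero bexI[of _ j]) auto
          then have "(\<Prod>z\<in>Z. \<bar>1 - real j / l z\<bar>) = 0"
            unfolding prodZ[of "\<lambda>x. \<bar>1 - real j / x\<bar>"] by (simp only: mult_zero_left)
          then show ?thesis using False by simp
        next
          case True
          have "(\<Prod>z\<in>Z. \<bar>1 - real j / l z\<bar>) \<le> (real p / (2 * real j)) ^ p * exp (72 * real j / real D)"
            unfolding prodZ[of "\<lambda>x. \<bar>1 - real j / x\<bar>"]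
            using discrete_chebyshev_bound[of p D j] p4 D True by (simp add: mult.commute)
          moreover have "72 * real j / real D \<le> 3 * \<alpha> / 2 * real j"
          proof -
            have "48 \<le> \<alpha> * real D" using \<alpha> by (simp add: field_simps)
            then have "48 * real j \<le> \<alpha> * real D * real j" by (intro mult_right_mono) auto
            then show ?thesis using pD by (simp add: field_simps)
          qed
          ultimately have "(\<Prod>z\<in>Z. \<bar>1 - real j / l z\<bar>) \<le> (real p / (2 * real j)) ^ p * exp (3 * \<alpha> / 2 * real j)"
            by (elim order_trans) (intro mult_left_mono, auto)
          then have "exp (- (3 * \<alpha> / 2) * real j) * (\<Prod>z\<in>Z. \<bar>1 - real j / l z\<bar>)
            \<le> exp (- (3 * \<alpha> / 2) * real j) * ((real p / (2 * real j)) ^ p * exp (3 * \<alpha> / 2 * real j))"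
            by (intro mult_left_mono) auto
          also have "\<dots> = (real p / (2 * real j)) ^ p" by (simp add: exp_minus)
          finally show ?thesis using True by simp
        qed
      qed
      also have "\<dots> = (\<Sum>j=p+1..n. (real p / (2 * real j)) ^ p)"
        by (intro sum.mono_neutral_cong_right) auto
      also have "\<dots> \<le> real p / 2 ^ p" using p4 by (intro sum_half_powers_le) auto
      also have "\<dots> \<le> 1 / (2 * M)"
        using double_times_le_two_power[OF M _ p] L M0 by (simp add: field_simps)
      finally show ?thesis .
    qed
  qed (use fin pD M0 c in auto)
  then show ?thesis unfolding card .
qed

section \<open>Sign patterns and small moments\<close>

text \<open>The cube of side \<open>T\<close> is cut into boxes of side \<open>\<delta>\<close>, at
  most \<open>T / \<delta> + 1\<close> along each of the \<open>m\<close> axes. Two points in the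
  same box differ by less than \<open>\<delta>\<close> in every coordinate.\<close>

lemma pigeonhole_boxes:
  fixes \<mu> :: "'a \<Rightarrow> nat \<Rightarrow> real" and T \<delta> :: real
  assumes "finite \<A>" "\<delta> > 0" "T \<ge> 0"
    and range: "\<And>x k. x \<in> \<A> \<Longrightarrow> k < m \<Longrightarrow> 0 \<le> \<mu> x k \<and> \<mu> x k \<le> T"
    and big: "(T / \<delta> + 1) ^ m < real (card \<A>)"
  shows "\<exists>x\<in>\<A>. \<exists>y\<in>\<A>. x \<noteq> y \<and> (\<forall>k<m. \<bar>\<mu> x k - \<mu> y k\<bar> < \<delta>)"
proof -
  define B where "B = nat \<lfloor>T / \<delta>\<rfloor>"
  define g where "g x = (\<lambda>k\<in>{..<m}. nat \<lfloor>\<mu> x k / \<delta>\<rfloor>)" for x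
  have g: "g x \<in> {..<m} \<rightarrow>\<^sub>E {..B}" if "x \<in> \<A>" for x
    unfolding g_def B_def using range[OF that] assms(2)
    by (auto intro!: nat_mono floor_mono divide_right_mono)
  have "real B \<le> T / \<delta>" unfolding B_def using assms by simp
  then have "real (card ({..<m} \<rightarrow>\<^sub>E {..B})) \<le> (T / \<delta> + 1) ^ m"
    by (simp add: card_funcsetE add.commute power_mono)
  then have "card ({..<m} \<rightarrow>\<^sub>E {..B}) < card \<A>" using big by linarith
  moreover have "g ` \<A> \<subseteq> {..<m} \<rightarrow>\<^sub>E {..B}" using g by blast
  ultimately have "\<not> inj_on g \<A>"
    using card_inj_on_le[of g \<A>] by (metis finite_PiE finite_atMost finite_lessThan not_le)
  then obtain x y where xy: "x \<in> \<A>" "y \<in> \<A>" "x \<noteq> y" "g x = g y" unfolding inj_on_def by blast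
  have "\<bar>\<mu> x k - \<mu> y k\<bar> < \<delta>" if "k < m" for k
  proof -
    have "nat \<lfloor>\<mu> x k / \<delta>\<rfloor> = nat \<lfloor>\<mu> y k / \<delta>\<rfloor>"
      using fun_cong[OF xy(4), of k] that by (simp add: g_def)
    moreover have "0 \<le> \<mu> x k / \<delta>" "0 \<le> \<mu> y k / \<delta>" using range xy that assms(2) by auto
    ultimately have "\<lfloor>\<mu> x k / \<delta>\<rfloor> = \<lfloor>\<mu> y k / \<delta>\<rfloor>" by (simp add: eq_nat_nat_iff)
    then have "\<bar>\<mu> x k / \<delta> - \<mu> y k / \<delta>\<bar> < 1" by linarith
    then show ?thesis using assms(2) by (simp add: field_simps flip: diff_divide_distrib)
  qed
  then show ?thesis using xy by blast
qed

text \<open>The largest of the distinct positive integers in a set is at least the cardinality of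
  the set; induction removes it.\<close>

lemma fact_card_le_prod:
  fixes A :: "nat set"
  assumes "finite A" "0 \<notin> A"
  shows "fact (card A) \<le> \<Prod>A"
  using assms
proof (induction A rule: finite_linorder_max_induct)
  case (insert b A)
  have "A \<subseteq> {1..<b}" using insert by (auto simp: Suc_le_eq intro!: gr0I)
  then have "card A \<le> card {1..<b}" by (intro card_mono) auto
  moreover have "b > 0" using insert.prems by (cases b) auto
  ultimately have "Suc (card A) \<le> b" by simp
  then have "Suc (card A) * fact (card A) \<le> b * \<Prod>A" using insert by (intro mult_le_mono) auto
  moreover have "b \<notin> A" using insert.hyps by auto
  ultimately show ?case using insert.hyps by simp
qed simp

lemma fact_add_le: "fact (a + b) \<le> (2 ^ (a + b) * (fact a * fact b) :: nat)"
proof -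
  have "fact (a + b) = fact a * fact b * ((a + b) choose a)"
    using binomial_fact_lemma[of a "a + b"] by simp
  also have "\<dots> \<le> fact a * fact b * 2 ^ (a + b)"
    using binomial_le_pow2[of "a + b" a] by (intro mult_le_mono2)
  finally show ?thesis by (simp add: mult.commute)
qed

text \<open>The doubled distances are odd positive integers, distinct among the points on either
  side of \<open>i\<close>. Each side therefore contributes at least a factorial. Merging the two
  factorials costs \<open>2 ^ card H\<close>, and undoing the doubling costs the same again.\<close>

lemma prod_half_integer_distances_ge:
  fixes H :: "nat set" and i :: nat
  assumes "finite H"
  shows "fact (card H) / 4 ^ card H \<le> \<bar>\<Prod>h\<in>H. real i - real h - 1/2\<bar>"
proof -
  define d where "d h = (if h < i then 2 * (i - h) - 1 else 2 * (h - i) + 1)" for h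
  let ?P = "{h\<in>H. h < i}" and ?Q = "{h\<in>H. \<not> h < i}"
  have d: "\<bar>real i - real h - 1/2\<bar> = real (d h) / 2" for h
    unfolding d_def by (auto simp: of_nat_diff)
  have part: "fact (card R) \<le> (\<Prod>h\<in>R. d h)" if "finite R" "inj_on d R" "\<forall>h\<in>R. d h > 0" for R
  proof -
    have "fact (card (d ` R)) \<le> \<Prod>(d ` R)" using that by (intro fact_card_le_prod) auto
    then show ?thesis using that by (simp add: card_image prod.reindex)
  qed
  have P: "fact (card ?P) \<le> (\<Prod>h\<in>?P. d h)"
    using assms by (intro part) (auto simp: inj_on_def d_def)
  have Q: "fact (card ?Q) \<le> (\<Prod>h\<in>?Q. d h)"
    using assms by (intro part) (auto simp: inj_on_def d_def)
  have H: "H = ?P \<union> ?Q" "?P \<inter> ?Q = {}" by auto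
  have c: "card H = card ?P + card ?Q" 
    using card_Un_disjoint[of ?P ?Q] H assms by simp
  have "(fact (card H) :: nat) \<le> 2 ^ card H * (fact (card ?P) * fact (card ?Q))"
    unfolding c by (rule fact_add_le)
  also have "\<dots> \<le> 2 ^ card H * ((\<Prod>h\<in>?P. d h) * (\<Prod>h\<in>?Q. d h))"
    using P Q by (intro mult_le_mono) auto
  also have "(\<Prod>h\<in>?P. d h) * (\<Prod>h\<in>?Q. d h) = (\<Prod>h\<in>H. d h)"
    using prod.union_disjoint[of ?P ?Q d] H assms by simp
  finally have "real (fact (card H)) \<le> real (2 ^ card H * (\<Prod>h\<in>H. d h))" by (rule of_nat_mono)
  then have "(fact (card H) :: nat) \<le> 2 ^ card H * (\<Prod>h\<in>H. real (d h))" by simp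
  moreover have "\<bar>\<Prod>h\<in>H. real i - real h - 1/2\<bar> = (\<Prod>h\<in>H. real (d h)) / 2 ^ card H"
    unfolding abs_prod d prod_dividef by simp
  moreover have "(4::real) ^ card H = 2 ^ card H * 2 ^ card H" by (simp flip: power_mult_distrib)
  ultimately show ?thesis by (simp add: field_simps)
qed

text \<open>The point is the supremum of the places in \<open>[a, b]\<close> where \<open>f\<close>
  is negative. To its right \<open>f\<close> is nonnegative, and negative values occur arbitrarily
  close on its left. Since zeros are isolated, both signs are strict near the point.\<close>

lemma exists_sign_change_upwards:
  fixes f :: "real \<Rightarrow> real"
  assumes f: "\<And>x. isCont f x" and fin: "finite {x. f x = 0}" and ab: "a < b"
    and fa: "f a < 0" and fb: "f b > 0"
  shows "\<exists>x>a. x < b \<and> (\<forall>\<^sub>F y in at_left x. sgn (f y) = -1) \<and> (\<forall>\<^sub>F y in at_right x. sgn (f y) = 1)"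
proof -
  have cont: "continuous_on S f" for S using f by (simp add: continuous_at_imp_continuous_on)
  define A where "A = {t\<in>{a..b}. f t < 0}"
  have A: "A \<noteq> {}" "bdd_above A" using fa ab unfolding A_def by (auto intro!: bdd_aboveI[of _ b] exI[of _ a])
  define x where "x = Sup A"
  have xb: "x \<le> b" "a \<le> x" unfolding x_def using A fa ab 
    by (auto intro!: cSup_least cSup_upper simp: A_def)
  have right: "f t \<ge> 0" if "x < t" "t \<le> b" for t
    using cSup_upper[OF _ A(2), of t] that xb unfolding x_def A_def by force
  have "f x \<le> 0"
  proof (rule ccontr)
    assume "\<not> ?thesis"
    then have "\<forall>\<^sub>F t in at x. f t > 0" using f[of x] unfolding isCont_def by (intro order_tendstoD(1)) auto
    then obtain e where e: "e > 0" "\<And>t. t \<noteq> x \<Longrightarrow> dist t x < e \<Longrightarrow> f t > 0"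
      unfolding eventually_at by auto
    obtain t where t: "t \<in> A" "x - e < t" using less_cSup_iff[OF A, of "x - e"] e(1) unfolding x_def by auto
    moreover have "t \<le> x" using cSup_upper[OF t(1) A(2)] unfolding x_def .
    ultimately show False using e(2)[of t] \<open>\<not> f x \<le> 0\<close> unfolding A_def by (cases "t = x") (auto simp: dist_real_def)
  qed
  then have "x \<noteq> b" using fb by auto
  with xb have "x < b" by simp
  have "f x \<ge> 0"
  proof (rule ccontr)
    assume "\<not> ?thesis"
    then have "\<forall>\<^sub>F t in at x. f t < 0" using f[of x] unfolding isCont_def by (intro order_tendstoD(2)) auto
    then obtain e where e: "e > 0" "\<And>t. t \<noteq> x \<Longrightarrow> dist t x < e \<Longrightarrow> f t < 0"
      unfolding eventually_at by auto
    obtain t where "x < t" "t \<le> b" "t < x + e"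
      using dense[of x "min b (x + e)"] \<open>x < b\<close> e(1) by auto
    then show False using right[of t] e(2)[of t] by (simp add: dist_real_def)
  qed
  then have "x \<noteq> a" using fa by auto
  with xb have "a < x" by simp
  obtain e where "e > 0" "\<forall>t\<in>{t. f t = 0}. t \<noteq> x \<longrightarrow> e \<le> dist x t"
    using finite_set_avoid[OF fin, of x] by auto
  then have e: "e > 0" "\<And>t. t \<noteq> x \<Longrightarrow> dist t x < e \<Longrightarrow> f t \<noteq> 0"
    by (auto simp: dist_commute)
  obtain s where s: "s \<in> A" "max a (x - e) < s"
    using less_cSup_iff[OF A, of "max a (x - e)"] e(1) \<open>a < x\<close> unfolding x_def by auto
  have "s \<le> x" using cSup_upper[OF s(1) A(2)] unfolding x_def .
  moreover have "s \<noteq> x" using s(1) \<open>f x \<ge> 0\<close> unfolding A_def by auto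
  ultimately have sx: "s < x" by simp
  have "\<forall>\<^sub>F y in at_left x. sgn (f y) = -1"
    unfolding eventually_at_left[OF sx]
  proof (intro exI[of _ s] conjI sx allI impI)
    fix y assume y: "s < y" "y < x"
    have "f y < 0"
    proof (rule ccontr)
      \<comment> \<open>Otherwise the intermediate value theorem gives a zero between
        \<open>s\<close> and \<open>y\<close>, inside the punctured neighbourhood of
        \<open>x\<close> that contains no zero.\<close>
      assume "\<not> f y < 0"
      then obtain t where "s \<le> t" "t \<le> y" "f t = 0"
        using IVT'[of f s 0 y] s(1) y cont unfolding A_def by auto
      then show False using e(2)[of t] y s by (auto simp: dist_real_def)
    qed
    then show "sgn (f y) = -1" by simp
  qed
  moreover have "\<forall>\<^sub>F y in at_right x. sgn (f y) = 1"
    unfolding eventually_at_right[OF \<open>x < b\<close>]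
  proof (intro exI[of _ "min b (x + e)"] conjI allI impI)
    show "x < min b (x + e)" using e(1) \<open>x < b\<close> by simp
    fix y assume y: "x < y" "y < min b (x + e)"
    then have "f y \<ge> 0" "f y \<noteq> 0" using right[of y] e(2)[of y] by (auto simp: dist_real_def)
    then show "sgn (f y) = 1" by simp
  qed
  ultimately show ?thesis using \<open>a < x\<close> \<open>x < b\<close> by blast
qed

lemma exists_sign_change_between:
  fixes f :: "real \<Rightarrow> real"
  assumes "\<And>x. isCont f x" "finite {x. f x = 0}" "a < b" "f a * f b < 0"
  shows "\<exists>x>a. x < b \<and> changes_sign_at f x"
proof (cases "f a < 0")
  case True
  then have "f b > 0" using assms(4) by (simp add: mult_less_0_iff)
  then show ?thesis
    using exists_sign_change_upwards[OF assms(1-3) True] unfolding changes_sign_at_def by fastforce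
next
  case False
  then have "- f a < 0" "- f b > 0" using assms(4) by (auto simp: mult_less_0_iff)
  then have "\<exists>x>a. x < b \<and> (\<forall>\<^sub>F y in at_left x. sgn (- f y) = -1) \<and> (\<forall>\<^sub>F y in at_right x. sgn (- f y) = 1)"
    using assms(1-3) by (intro exists_sign_change_upwards) auto
  then obtain x where x: "a < x" "x < b" "\<forall>\<^sub>F y in at_left x. sgn (- f y) = -1"
    "\<forall>\<^sub>F y in at_right x. sgn (- f y) = 1" by blast
  have "\<forall>\<^sub>F y in at_left x. sgn (f y) = 1" "\<forall>\<^sub>F y in at_right x. sgn (f y) = -1"
    using x(3,4) by (auto elim!: eventually_mono simp: sgn_minus)
  then show ?thesis using x(1,2) unfolding changes_sign_at_def by auto
qed

text \<open>
  An index \<open>h \<in> H\<close> stands for the half-integer zero \<open>h + 1/2\<close>. The last conjunct drives the induction: it keeps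
  track of the last node at which \<open>f\<close> does not vanish.
\<close>

lemma sign_pattern:
  fixes f :: "real \<Rightarrow> real" and y :: "nat \<Rightarrow> real"
  assumes f: "\<And>x. isCont f x" "finite {x. f x = 0}" and y: "\<And>i j. i < j \<Longrightarrow> y j < y i"
  shows "\<exists>H X \<sigma>. H \<subseteq> {..<K} \<and> \<sigma> \<in> {-1, 1::real} \<and> finite X \<and> card X = card H \<and>
    X \<subseteq> {x. y K < x \<and> x < y 0 \<and> changes_sign_at f x} \<and>
    (\<forall>i\<le>K. 0 \<le> \<sigma> * f (y i) * (\<Prod>h\<in>H. real i - real h - 1/2)) \<and>
    (H = {} \<and> (\<forall>i\<le>K. f (y i) = 0) \<or> (\<exists>l\<le>K. 0 < \<sigma> * f (y l) \<and> (\<forall>x\<in>X. y l < x)))"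
proof (induction K)
  case 0
  show ?case
    by (rule exI[of _ "{}"], rule exI[of _ "{}"], rule exI[of _ "if f (y 0) < 0 then -1 else 1"]) auto
next
  case (Suc K)
  then obtain H X \<sigma> where H: "H \<subseteq> {..<K}" and \<sigma>: "\<sigma> \<in> {-1, 1::real}" and X: "finite X" "card X = card H"
    "X \<subseteq> {x. y K < x \<and> x < y 0 \<and> changes_sign_at f x}"
    and nn: "\<And>i. i \<le> K \<Longrightarrow> 0 \<le> \<sigma> * f (y i) * (\<Prod>h\<in>H. real i - real h - 1/2)"
    and last: "H = {} \<and> (\<forall>i\<le>K. f (y i) = 0) \<or> (\<exists>l\<le>K. 0 < \<sigma> * f (y l) \<and> (\<forall>x\<in>X. y l < x))"
    by blast
  have yK: "y (Suc K) < y K" using y by simp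
  have X': "X \<subseteq> {x. y (Suc K) < x \<and> x < y 0 \<and> changes_sign_at f x}" using X(3) yK by auto
  have pos: "(\<Prod>h\<in>H. real (Suc K) - real h - 1/2) > 0"
    using H by (intro prod_pos) force
  let ?v = "\<sigma> * f (y (Suc K))"
  \<comment> \<open>If the new value does not contradict the current sign, \<open>H\<close> stays.
    If it does but all earlier values vanish, flipping \<open>\<sigma>\<close> suffices. Otherwise
    \<open>f\<close> changes sign after the node \<open>l\<close>, and the half-integer
    \<open>K + 1/2\<close> joins the zeros while \<open>\<sigma>\<close> flips.\<close>
  consider (keep) "?v \<ge> 0" | (flat) "?v < 0" "H = {}" "\<forall>i\<le>K. f (y i) = 0"
    | (flip) l where "?v < 0" "l \<le> K" "0 < \<sigma> * f (y l)" "\<forall>x\<in>X. y l < x"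
    using last by force
  then show ?case
  proof cases
    case keep
    have "0 \<le> \<sigma> * f (y i) * (\<Prod>h\<in>H. real i - real h - 1/2)" if "i \<le> Suc K" for i
    proof (cases "i = Suc K")
      case True
      then show ?thesis using mult_nonneg_nonneg[OF keep less_imp_le[OF pos]] by simp
    qed (use nn that in auto)
    moreover have "H = {} \<and> (\<forall>i\<le>Suc K. f (y i) = 0) \<or> (\<exists>l\<le>Suc K. 0 < \<sigma> * f (y l) \<and> (\<forall>x\<in>X. y l < x))"
      using last
    proof
      assume a: "H = {} \<and> (\<forall>i\<le>K. f (y i) = 0)"
      then have "X = {}" using X by simp
      show ?thesis
      proof (cases "f (y (Suc K)) = 0")
        case True
        then show ?thesis using a by (auto simp: le_Suc_eq)
      next
        case False
        then have "0 < ?v" using keep \<sigma> by auto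
        then show ?thesis using \<open>X = {}\<close> by auto
      qed
    next
      assume "\<exists>l\<le>K. 0 < \<sigma> * f (y l) \<and> (\<forall>x\<in>X. y l < x)"
      then show ?thesis using le_SucI by blast
    qed
    moreover have "H \<subseteq> {..<Suc K}" using H by auto
    ultimately show ?thesis using \<sigma> X X' by blast
  next
    case flat
    then have "X = {}" using X by simp
    show ?thesis
    proof (rule exI[of _ "{}"], rule exI[of _ "{}"], rule exI[of _ "- \<sigma>"], intro conjI allI impI disjI2)
      show "\<exists>l\<le>Suc K. 0 < - \<sigma> * f (y l) \<and> (\<forall>x\<in>{}. y l < x)" using flat by auto
      show "0 \<le> - \<sigma> * f (y i) * (\<Prod>h\<in>{}. real i - real h - 1/2)" if "i \<le> Suc K" for i
        using that flat by (auto simp: le_Suc_eq)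
    qed (use \<sigma> in auto)
  next
    case (flip l)
    have "y (Suc K) < y l" using y flip by simp
    moreover have "f (y (Suc K)) * f (y l) < 0" using flip \<sigma> by (auto simp: mult_less_0_iff)
    ultimately obtain x where x: "y (Suc K) < x" "x < y l" "changes_sign_at f x"
      using exists_sign_change_between[OF f] by blast
    \<comment> \<open>The new sign change lies below \<open>y l\<close>, and all recorded ones lie
      above it.\<close>
    have "x \<notin> X" using flip x by force
    have "K \<notin> H" "finite H" using H finite_subset by auto
    have "y l \<le> y 0" using y[of 0 l] by (cases "l = 0") auto
    show ?thesis
    proof (rule exI[of _ "insert K H"], rule exI[of _ "insert x X"], rule exI[of _ "- \<sigma>"],
        intro conjI allI impI disjI2)
      show "insert x X \<subseteq> {x. y (Suc K) < x \<and> x < y 0 \<and> changes_sign_at f x}"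
        using X' x \<open>y l \<le> y 0\<close> by auto
      show "card (insert x X) = card (insert K H)"
        using X \<open>x \<notin> X\<close> \<open>K \<notin> H\<close> \<open>finite H\<close> by simp
      show "0 \<le> - \<sigma> * f (y i) * (\<Prod>h\<in>insert K H. real i - real h - 1/2)" if "i \<le> Suc K" for i
      proof (cases "i = Suc K")
        case True
        have "0 \<le> - \<sigma> * f (y i)" "0 \<le> (\<Prod>h\<in>H. real i - real h - 1/2) * (1/2)"
          using pos flip(1) True by auto
        then have "0 \<le> (- \<sigma> * f (y i)) * ((\<Prod>h\<in>H. real i - real h - 1/2) * (1/2))"
          by (rule mult_nonneg_nonneg)
        then show ?thesis using True \<open>K \<notin> H\<close> \<open>finite H\<close> by (simp add: mult_ac)
      next
        case False
        then have "i \<le> K" using that by simp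
        \<comment> \<open>At the old indices the new factor \<open>i - K - 1/2\<close> is negative,
          which the flip of \<open>\<sigma>\<close> compensates.\<close>
        then have "0 \<le> (\<sigma> * f (y i) * (\<Prod>h\<in>H. real i - real h - 1/2)) * (real K + 1/2 - real i)"
          by (intro mult_nonneg_nonneg[OF nn]) auto
        also have "\<dots> = - \<sigma> * f (y i) * (\<Prod>h\<in>insert K H. real i - real h - 1/2)"
          using \<open>K \<notin> H\<close> \<open>finite H\<close> by (simp add: algebra_simps)
        finally show ?thesis .
      qed
      show "\<exists>l\<le>Suc K. 0 < - \<sigma> * f (y l) \<and> (\<forall>x\<in>insert x X. y l < x)"
        using flip x X' by (intro exI[of _ "Suc K"]) auto
    qed (use \<sigma> X H in auto)
  qed
qed

text \<open>Let \<open>Q\<close> have the zeros \<open>h + 1/2\<close> for \<open>h\<close> in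
  \<open>H\<close>. By the sign condition the sum of \<open>\<bar>v i * Q i\<bar>\<close> equals the
  absolute value of the sum of \<open>v i * Q i\<close>, a combination of moments because
  \<open>Q\<close> has degree below \<open>m\<close>. Rescaling to \<open>[0, 1]\<close> costs
  \<open>K ^ r\<close> with \<open>r = card H\<close>, the coefficients cost \<open>2 ^ r\<close>,
  and \<open>\<bar>Q i\<bar>\<close> is at least \<open>fact r / 4 ^ r\<close>. The result is
  \<open>(8 * K) ^ r / fact r\<close>, which \<open>exp (8 * K)\<close> bounds for every
  \<open>r\<close>.\<close>

lemma abs_le_of_small_moments:
  fixes v :: "nat \<Rightarrow> real" and \<delta> \<sigma> :: real
  assumes K: "K \<ge> 1" and H: "H \<subseteq> {..<K}" "card H < m" and \<sigma>: "\<sigma> \<in> {-1, 1}"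
    and nn: "\<And>i. i \<le> K \<Longrightarrow> 0 \<le> \<sigma> * v i * (\<Prod>h\<in>H. real i - real h - 1/2)"
    and mom: "\<And>k. k < m \<Longrightarrow> \<bar>\<Sum>i\<le>K. v i * (real i / real K) ^ k\<bar> \<le> \<delta>"
    and i: "i \<le> K"
  shows "\<bar>v i\<bar> \<le> \<delta> * exp (8 * real K)"
proof -
  have fin: "finite H" using H finite_subset by blast
  let ?r = "card H"
  let ?Q = "\<lambda>i. \<Prod>h\<in>H. real i - real h - 1/2"
  define B where "B h = - (real h + 1/2) / real K" for h
  have K0: "real K > 0" using K by simp
  obtain w where w: "\<And>x. (\<Prod>h\<in>H. 1 * x + B h) = (\<Sum>k\<le>?r. w k * x ^ k)"
    and wS: "(\<Sum>k\<le>?r. \<bar>w k\<bar>) \<le> (\<Prod>h\<in>H. \<bar>1\<bar> + \<bar>B h\<bar>)"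
    using prod_linear_expand[OF fin, of "\<lambda>_. 1" B] by blast
  have "(\<Prod>h\<in>H. \<bar>1\<bar> + \<bar>B h\<bar>) \<le> (\<Prod>h\<in>H. 2)"
  proof (intro prod_mono conjI)
    fix h assume "h \<in> H"
    then have "real h + 1/2 \<le> real K" using H by force
    then show "\<bar>1\<bar> + \<bar>B h\<bar> \<le> 2" unfolding B_def using K0 by (simp add: field_simps)
  qed auto
  then have wS: "(\<Sum>k\<le>?r. \<bar>w k\<bar>) \<le> 2 ^ ?r" using wS by simp
  have Q: "(\<Prod>h\<in>H. 1 * (real i / real K) + B h) = ?Q i / real K ^ ?r" for i
  proof -
    have "1 * (real i / real K) + B h = (real i - real h - 1/2) / real K" for h
      using K0 by (simp add: B_def field_simps)
    then show ?thesis by (simp only: prod_dividef prod_constant)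
  qed
  have \<delta>: "\<delta> \<ge> 0" using mom[of 0] H(2) by fastforce
  have "(\<Sum>i\<le>K. \<bar>v i\<bar> * \<bar>?Q i\<bar>) = \<bar>\<Sum>i\<le>K. v i * ?Q i\<bar>"
  proof -
    have "\<bar>v i\<bar> * \<bar>?Q i\<bar> = \<sigma> * (v i * ?Q i)" if "i \<le> K" for i
      using nn[OF that] \<sigma> by (auto simp: abs_mult[symmetric])
    then have e: "(\<Sum>i\<le>K. \<bar>v i\<bar> * \<bar>?Q i\<bar>) = \<sigma> * (\<Sum>i\<le>K. v i * ?Q i)"
      by (simp add: sum_distrib_left)
    have "(\<Sum>i\<le>K. \<bar>v i\<bar> * \<bar>?Q i\<bar>) \<ge> 0" by (intro sum_nonneg) auto
    then show ?thesis using e \<sigma> by auto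
  qed
  also have "(\<Sum>i\<le>K. v i * ?Q i) = real K ^ ?r * (\<Sum>i\<le>K. v i * (?Q i / real K ^ ?r))"
    using K0 by (simp add: sum_distrib_left)
  also have "(\<Sum>i\<le>K. v i * (?Q i / real K ^ ?r)) = (\<Sum>k\<le>?r. w k * (\<Sum>i\<le>K. v i * (real i / real K) ^ k))"
    unfolding Q[symmetric] w sum_distrib_left
    by (subst sum.swap) (intro sum.cong refl, simp only: mult_ac)
  also have "\<bar>real K ^ ?r * (\<Sum>k\<le>?r. w k * (\<Sum>i\<le>K. v i * (real i / real K) ^ k))\<bar>
      \<le> real K ^ ?r * (\<Sum>k\<le>?r. \<bar>w k\<bar> * \<delta>)"
    unfolding abs_mult[of "real K ^ ?r"]
  proof (intro mult_mono order_trans[OF sum_abs] sum_mono)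
    fix k assume "k \<in> {..?r}"
    then show "\<bar>w k * (\<Sum>i\<le>K. v i * (real i / real K) ^ k)\<bar> \<le> \<bar>w k\<bar> * \<delta>"
      unfolding abs_mult using mom[of k] H(2) by (intro mult_left_mono) auto
  qed auto
  also have "(\<Sum>k\<le>?r. \<bar>w k\<bar> * \<delta>) = (\<Sum>k\<le>?r. \<bar>w k\<bar>) * \<delta>" by (simp only: sum_distrib_right)
  also have "real K ^ ?r * ((\<Sum>k\<le>?r. \<bar>w k\<bar>) * \<delta>) \<le> real K ^ ?r * (2 ^ ?r * \<delta>)"
    using wS \<delta> by (intro mult_left_mono mult_right_mono) auto
  finally have sum: "(\<Sum>i\<le>K. \<bar>v i\<bar> * \<bar>?Q i\<bar>) \<le> real K ^ ?r * (2 ^ ?r * \<delta>)" .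
  have "\<bar>v i\<bar> * (fact ?r / 4 ^ ?r) \<le> \<bar>v i\<bar> * \<bar>?Q i\<bar>"
    by (intro mult_left_mono prod_half_integer_distances_ge fin) auto
  also have "\<dots> \<le> (\<Sum>i\<le>K. \<bar>v i\<bar> * \<bar>?Q i\<bar>)" using i by (intro member_le_sum) auto
  also note sum
  finally have "\<bar>v i\<bar> * fact ?r \<le> real K ^ ?r * (2 ^ ?r * \<delta>) * 4 ^ ?r"
    by (simp add: pos_divide_le_eq)
  also have "\<dots> = \<delta> * (8 * real K) ^ ?r"
  proof -
    have "(8 * real K) ^ ?r = (2 * 4 * real K) ^ ?r" by simp
    also have "\<dots> = 2 ^ ?r * 4 ^ ?r * real K ^ ?r" by (simp only: power_mult_distrib)
    finally show ?thesis by (simp only: mult_ac)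
  qed
  finally have "\<bar>v i\<bar> \<le> \<delta> * ((8 * real K) ^ ?r / fact ?r)" by (simp add: field_simps)
  also have "\<dots> \<le> \<delta> * exp (8 * real K)"
    using \<delta> by (intro mult_left_mono power_div_fact_le_exp) auto
  finally show ?thesis .
qed

text \<open>The pigeonhole principle is applied to the \<open>2 ^ (n + 1)\<close> polynomials with
  coefficients \<open>0\<close> or \<open>a j\<close>. The difference of two indicator functions
  takes values in \<open>{-1, 0, 1}\<close>, and it is not identically zero if the subsets
  differ.\<close>

lemma exists_small_moments:
  fixes a y :: "nat \<Rightarrow> real" and M \<delta> :: real and n K m :: nat
  assumes a: "\<And>j. j \<le> n \<Longrightarrow> 1 \<le> a j \<and> a j \<le> M" and y: "\<And>i. i \<le> K \<Longrightarrow> 0 \<le> y i \<and> y i \<le> 1" and "\<delta> > 0"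
    and big: "((real K + 1) * (real n + 1) * M / \<delta> + 1) ^ m < 2 ^ (n + 1)"
  shows "\<exists>b. (\<forall>j\<le>n. b j \<in> {-1, 0, 1}) \<and> (\<exists>j\<le>n. b j \<noteq> 0) \<and>
    (\<forall>k<m. \<bar>\<Sum>i\<le>K. (\<Sum>j\<le>n. b j * a j * y i ^ j) * (real i / real K) ^ k\<bar> < \<delta>)"
proof -
  let ?P = "\<lambda>A i. \<Sum>j\<le>n. of_bool (j \<in> A) * a j * y i ^ j"
  define \<mu> where "\<mu> A k = (\<Sum>i\<le>K. ?P A i * (real i / real K) ^ k)" for A k
  have M: "M \<ge> 1" using a[of 0] by linarith
  have range: "0 \<le> \<mu> A k \<and> \<mu> A k \<le> (real K + 1) * (real n + 1) * M" for A k
  proof -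
    have P: "0 \<le> ?P A i \<and> ?P A i \<le> (real n + 1) * M" if "i \<le> K" for i
    proof
      have t: "0 \<le> of_bool (j \<in> A) * a j * y i ^ j \<and> of_bool (j \<in> A) * a j * y i ^ j \<le> M" if "j \<le> n" for j
      proof -
        have "0 \<le> y i ^ j" "y i ^ j \<le> 1" using y[OF \<open>i \<le> K\<close>] by (auto intro: power_le_one)
        then have "0 \<le> a j * y i ^ j" "a j * y i ^ j \<le> M * 1"
          using a[OF that] M by (simp, intro mult_mono) auto
        then show ?thesis using M by simp
      qed
      then show "0 \<le> ?P A i" by (intro sum_nonneg) auto
      have "?P A i \<le> (\<Sum>j\<le>n. M)" using t by (intro sum_mono) auto
      then show "?P A i \<le> (real n + 1) * M" by (simp add: algebra_simps)
    qed
    have t: "0 \<le> ?P A i * (real i / real K) ^ k \<and> ?P A i * (real i / real K) ^ k \<le> (real n + 1) * M"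
      if "i \<le> K" for i
    proof -
      have "0 \<le> (real i / real K) ^ k" "(real i / real K) ^ k \<le> 1"
        using that by (auto intro!: power_le_one simp: divide_le_eq_1)
      then have "?P A i * (real i / real K) ^ k \<le> (real n + 1) * M * 1"
        using P[OF that] M by (intro mult_mono) auto
      then show ?thesis using P[OF that] \<open>0 \<le> (real i / real K) ^ k\<close> by (simp add: mult_nonneg_nonneg)
    qed
    have "\<mu> A k \<le> (\<Sum>i\<le>K. (real n + 1) * M)" unfolding \<mu>_def using t by (intro sum_mono) auto
    moreover have "0 \<le> \<mu> A k" unfolding \<mu>_def using t by (intro sum_nonneg) auto
    ultimately show ?thesis by (simp add: algebra_simps)
  qed
  have "\<exists>A\<in>Pow {..n}. \<exists>B\<in>Pow {..n}. A \<noteq> B \<and> (\<forall>k<m. \<bar>\<mu> A k - \<mu> B k\<bar> < \<delta>)"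
    using range big M \<open>\<delta> > 0\<close> by (intro pigeonhole_boxes) (auto simp: card_Pow)
  then obtain A B where AB: "A \<subseteq> {..n}" "B \<subseteq> {..n}" "A \<noteq> B" "\<And>k. k < m \<Longrightarrow> \<bar>\<mu> A k - \<mu> B k\<bar> < \<delta>"
    by blast
  define b :: "nat \<Rightarrow> real" where "b j = of_bool (j \<in> A) - of_bool (j \<in> B)" for j
  have "(\<Sum>i\<le>K. (\<Sum>j\<le>n. b j * a j * y i ^ j) * (real i / real K) ^ k) = \<mu> A k - \<mu> B k" for k
    unfolding \<mu>_def b_def by (simp add: left_diff_distrib sum_subtractf)
  moreover have "\<exists>j\<le>n. b j \<noteq> 0"
  proof -
    obtain j where "j \<in> A \<longleftrightarrow> j \<notin> B" using AB(3) by blast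
    then show ?thesis using AB(1,2) by (intro exI[of _ j]) (auto simp: b_def)
  qed
  ultimately show ?thesis using AB(4) by (intro exI[of _ b]) (auto simp: b_def)
qed

section \<open>Choice of parameters and conclusion\<close>

lemma polyfun_factor_lowest:
  fixes g :: "nat \<Rightarrow> real"
  assumes "\<And>j. j < d \<Longrightarrow> g j = 0" "d \<le> n"
  shows "(\<Sum>j\<le>n. g j * x ^ j) = x ^ d * (\<Sum>j\<le>n. (if j + d \<le> n then g (j + d) else 0) * x ^ j)"
proof -
  have "(\<Sum>j\<le>n. g j * x ^ j) = (\<Sum>j\<in>{d..n}. g j * x ^ j)"
    using assms by (intro sum.mono_neutral_right) auto
  also have "\<dots> = (\<Sum>j\<le>n - d. g (j + d) * x ^ (j + d))"
    using assms by (intro sum.reindex_bij_witness[of _ "\<lambda>j. j + d" "\<lambda>j. j - d"]) auto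
  also have "\<dots> = x ^ d * (\<Sum>j\<le>n - d. g (j + d) * x ^ j)"
    by (simp add: sum_distrib_left power_add mult_ac)
  also have "(\<Sum>j\<le>n - d. g (j + d) * x ^ j) = (\<Sum>j\<le>n. (if j + d \<le> n then g (j + d) else 0) * x ^ j)"
    using assms(2) by (intro sum.mono_neutral_cong_left) auto
  finally show ?thesis .
qed

text \<open>This makes the set of sign changes finite for a nonzero polynomial; without finiteness
  \<open>card\<close> could be 0 and would say nothing about the sign changes found.\<close>

lemma changes_sign_at_imp_zero:
  fixes f :: "real \<Rightarrow> real"
  assumes "isCont f x" "changes_sign_at f x"
  shows "f x = 0"
proof (rule ccontr)
  assume nz: "f x \<noteq> 0"
  obtain s where s: "s \<in> {-1, 1}" "\<forall>\<^sub>F y in at_left x. sgn (f y) = s" "\<forall>\<^sub>F y in at_right x. sgn (f y) = - s"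
    using assms(2) unfolding changes_sign_at_def by blast
  have "\<forall>\<^sub>F y in at x. sgn (f y) = sgn (f x)"
  proof (cases "f x > 0")
    case True
    then have "\<forall>\<^sub>F y in at x. f y > 0" using assms(1) unfolding isCont_def by (rule order_tendstoD(1)[rotated])
    then show ?thesis by (rule eventually_mono) (use True in simp)
  next
    case False
    then have "f x < 0" using nz by simp
    then have "\<forall>\<^sub>F y in at x. f y < 0" using assms(1) unfolding isCont_def by (rule order_tendstoD(2)[rotated])
    then show ?thesis by (rule eventually_mono) (use \<open>f x < 0\<close> in simp)
  qed
  then have near: "\<forall>\<^sub>F y in at_left x. sgn (f y) = sgn (f x)" "\<forall>\<^sub>F y in at_right x. sgn (f y) = sgn (f x)"
    by (auto simp: eventually_at_split)
  have "\<forall>\<^sub>F y in at_left x. s = sgn (f x)" using near(1) s(2) by eventually_elim simp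
  moreover have "\<forall>\<^sub>F y in at_right x. - s = sgn (f x)" using near(2) s(3) by eventually_elim simp
  ultimately have "s = sgn (f x)" "- s = sgn (f x)" by auto
  then show False using s(1) by auto
qed

text \<open>All quantities are measured by \<open>\<Lambda> = L / \<alpha> = \<alpha> * n\<close>.
  Fewer than \<open>m\<close> sign changes would give
  \<open>\<bar>f (y i)\<bar> \<le> exp (- 1740 * \<Lambda>)\<close> at every node, whereas some node
  has a value of at least \<open>exp (- 1718 * \<Lambda>)\<close>. The bound on \<open>m\<close>
  keeps the number of boxes below \<open>2 ^ (n + 1)\<close>.\<close>

lemma exists_many_sign_changes:
  fixes a :: "nat \<Rightarrow> real" and \<alpha> L M :: real and n m :: nat
  assumes \<alpha>: "0 < \<alpha>" "\<alpha> \<le> 1/3" and L: "1 \<le> L" and M: "4 * M = exp L" and n: "real n * \<alpha>\<^sup>2 = L"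
    and a: "\<And>j. j \<le> n \<Longrightarrow> 1 \<le> a j \<and> a j \<le> M" and m: "8000 * \<alpha> * real m \<le> 1"
  shows "\<exists>b. (\<forall>j\<le>n. b j \<in> {-1, 0, 1}) \<and>
    m \<le> card (sign_changes_in (\<lambda>z. \<Sum>j\<le>n. b j * a j * z ^ j) {1 - 2 * \<alpha> <..< 1 - \<alpha>})"
proof -
  define \<Lambda> where "\<Lambda> = L / \<alpha>"
  have \<Lambda>: "\<Lambda> \<ge> 3" "L \<le> \<Lambda>" "\<alpha> * real n = \<Lambda>" "\<alpha> * \<Lambda> = L"
    using \<alpha> L n mult_mono[of 3 3 \<alpha> "1/3"] unfolding \<Lambda>_def
    by (auto simp: field_simps power2_eq_square intro: order_trans[OF _ L])
  define p where "p = nat \<lceil>4 * L\<rceil>"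
  define D where "D = nat \<lceil>48 / \<alpha>\<rceil>"
  have p: "4 * L \<le> real p" "real p \<le> 5 * L" unfolding p_def using L by linarith+
  have ia: "1 / \<alpha> \<ge> 3" using \<alpha> by (simp add: field_simps)
  have "48 / \<alpha> \<le> real D" "real D \<le> 48 / \<alpha> + 1" unfolding D_def using \<alpha> by (auto simp: of_nat_ceiling)
  moreover have "48 / \<alpha> = 48 * (1 / \<alpha>)" "49 / \<alpha> = 49 * (1 / \<alpha>)" by simp_all
  ultimately have D: "48 / \<alpha> \<le> real D" "real D \<le> 49 / \<alpha>" "real D \<ge> 144" using ia by linarith+
  have p4: "real p \<ge> 4" using p L by linarith
  define K where "K = p * (D - 2)"
  define h where "h = \<alpha> / (8 * real p * real D)"
  have h0: "h > 0" using \<alpha> p4 D by (simp add: h_def)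
  have "real p * real D \<le> (5 * L) * (49 / \<alpha>)" using p D L by (intro mult_mono) auto
  then have pD: "real p * real D \<le> 245 * \<Lambda>" by (simp add: \<Lambda>_def)
  have KpD: "real K \<le> real p * real D"
    unfolding K_def of_nat_mult using D by (intro mult_left_mono) (auto simp: of_nat_diff)
  then have K: "real K \<le> 245 * \<Lambda>" using pD by linarith
  have K1: "K \<ge> 1" using p4 D unfolding K_def by (simp add: Suc_le_eq)
  have Kh: "real K * h \<le> \<alpha> / 8"
  proof -
    have "real K * h \<le> real p * real D * h" using KpD h0 by (intro mult_right_mono) auto
    also have "\<dots> = \<alpha> / 8" using p4 D by (simp add: h_def)
    finally show ?thesis .
  qed
  define y where "y i = exp (- (3 * \<alpha> / 2 + real i * h))" for i
  have y_dec: "y j < y i" if "i < j" for i j using that h0 by (simp add: y_def)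
  have y0: "y 0 < 1 - \<alpha>"
  proof -
    have sq: "\<alpha>\<^sup>2 \<le> \<alpha> * (1/3)" using \<alpha> unfolding power2_eq_square by (intro mult_left_mono) auto
    have "\<alpha> * \<alpha>\<^sup>2 \<le> \<alpha> * (\<alpha> * (1/3))" using sq \<alpha> by (intro mult_left_mono) auto
    then have cube: "\<alpha> ^ 3 \<le> \<alpha>\<^sup>2 * (1/3)" by (simp add: power2_eq_square power3_eq_cube)
    \<comment> \<open>The claim amounts to
      \<open>(1 - \<alpha>) * exp (3 * \<alpha> / 2) > 1\<close>. The quadratic Taylor bound
      suffices, since the gain \<open>\<alpha> / 2\<close> outweighs the higher terms when
      \<open>\<alpha> \<le> 1/3\<close>.\<close>
    have "(1 - \<alpha>) * (1 + 3 * \<alpha> / 2 + (3 * \<alpha> / 2)\<^sup>2 / 2) = 1 + \<alpha> / 2 - 3 / 8 * \<alpha>\<^sup>2 - 9 / 8 * \<alpha> ^ 3"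
      by (simp add: field_simps power2_eq_square power3_eq_cube)
    then have "1 < (1 - \<alpha>) * (1 + 3 * \<alpha> / 2 + (3 * \<alpha> / 2)\<^sup>2 / 2)"
      using sq cube \<alpha> by linarith
    also have "\<dots> \<le> (1 - \<alpha>) * exp (3 * \<alpha> / 2)"
      using \<alpha> by (intro mult_left_mono exp_lower_Taylor_quadratic) auto
    finally show ?thesis by (simp add: y_def exp_minus field_simps)
  qed
  have yK: "1 - 2 * \<alpha> < y K"
  proof -
    have "1 - 2 * \<alpha> < 1 + - (3 * \<alpha> / 2 + real K * h)" using Kh \<alpha> by linarith
    also have "\<dots> \<le> y K" unfolding y_def by (rule exp_ge_add_one_self)
    finally show ?thesis .
  qed
  have yi: "exp (- (2 * \<alpha>)) \<le> y i" "0 < y i" "y i \<le> 1" if "i \<le> K" for i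
  proof -
    have "real i * h \<le> real K * h" using that h0 by (intro mult_right_mono) auto
    then show "exp (- (2 * \<alpha>)) \<le> y i" using Kh \<alpha> by (simp add: y_def)
    have "0 \<le> 3 * \<alpha> / 2 + real i * h" using h0 \<alpha> by (intro add_nonneg_nonneg) auto
    then show "y i \<le> 1" by (simp add: y_def)
  qed (simp add: y_def)
  \<comment> \<open>The exponent must exceed \<open>8 * 245 = 1960\<close>, the loss in passing from
    moments to values, plus 1718, the exponent of the lower bound at a node.\<close>
  define \<delta> where "\<delta> = exp (- 3700 * \<Lambda>)"
  have M1: "M \<ge> 1" using a[of 0] by linarith
  have big: "((real K + 1) * (real n + 1) * M / \<delta> + 1) ^ m < 2 ^ (n + 1)"
  proof -
    have "real K + 1 \<le> exp (245 * \<Lambda>)"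
      using exp_ge_add_one_self[of "245 * \<Lambda>"] K by linarith
    moreover have "real n + 1 \<le> exp (2 * \<Lambda>)"
    proof -
      have "\<Lambda>\<^sup>2 = real n * L"
        using \<Lambda>(3,4) by (simp add: power2_eq_square) (metis mult.assoc mult.commute)
      then have "real n \<le> \<Lambda>\<^sup>2" using L mult_left_mono[of 1 L "real n"] by simp
      then have "real n + 1 \<le> (1 + \<Lambda>)\<^sup>2" using \<Lambda>(1) by (simp add: power2_sum)
      also have "\<dots> \<le> (exp \<Lambda>)\<^sup>2" using \<Lambda>(1) by (intro power_mono) auto
      finally show ?thesis by (simp add: exp_double)
    qed
    moreover have "M \<le> exp \<Lambda>"
    proof -
      have "M \<le> exp L" using M M1 by linarith
      also have "\<dots> \<le> exp \<Lambda>" using \<Lambda>(2) by simp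
      finally show ?thesis .
    qed
    ultimately have "(real K + 1) * (real n + 1) * M \<le> exp (245 * \<Lambda>) * exp (2 * \<Lambda>) * exp \<Lambda>"
      using M1 by (intro mult_mono) auto
    also have "\<dots> = exp (248 * \<Lambda>)" by (simp add: exp_add[symmetric])
    finally have "(real K + 1) * (real n + 1) * M / \<delta> \<le> exp (248 * \<Lambda>) / \<delta>"
      unfolding \<delta>_def by (intro divide_right_mono) auto
    also have "\<dots> = exp (3948 * \<Lambda>)" unfolding \<delta>_def by (simp add: exp_diff[symmetric])
    finally have "(real K + 1) * (real n + 1) * M / \<delta> + 1 \<le> exp (3948 * \<Lambda>) + 1" by simp
    also have "\<dots> \<le> exp (3948 * \<Lambda>) * (1 + \<Lambda>)"
    proof -
      have "1 \<le> exp (3948 * \<Lambda>) * \<Lambda>"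
        using \<Lambda>(1) mult_mono[of 1 "exp (3948 * \<Lambda>)" 1 \<Lambda>] by simp
      then show ?thesis by (simp add: algebra_simps)
    qed
    also have "\<dots> \<le> exp (3948 * \<Lambda>) * exp \<Lambda>"
      by (intro mult_left_mono exp_ge_add_one_self) auto
    also have "\<dots> = exp (3949 * \<Lambda>)" by (simp add: exp_add[symmetric])
    finally have "((real K + 1) * (real n + 1) * M / \<delta> + 1) ^ m \<le> exp (3949 * \<Lambda>) ^ m"
      using M1 by (intro power_mono) (auto simp: \<delta>_def intro!: add_nonneg_nonneg divide_nonneg_pos)
    also have "\<dots> = exp (real m * (3949 * \<Lambda>))" by (simp only: exp_of_nat_mult)
    also have "\<dots> < exp (real (n + 1) * ln 2)"
    proof -
      \<comment> \<open>As \<open>\<alpha> * n = \<Lambda>\<close>, this turns the bound on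
        \<open>m\<close> into \<open>8000 * m * \<Lambda> \<le> n\<close>, so the exponent
        \<open>3949 * m * \<Lambda>\<close> stays below \<open>n / 2\<close>.\<close>
      have "real n * (8000 * \<alpha> * real m) \<le> real n * 1" using m by (intro mult_left_mono) auto
      then have "8000 * (real m * \<Lambda>) \<le> real n" unfolding \<Lambda>(3)[symmetric] by (simp add: mult_ac)
      moreover have "real m * \<Lambda> \<ge> 0" using \<Lambda>(1) by simp
      ultimately have "real m * (3949 * \<Lambda>) < real (n + 1) * (2/3)" by simp
      also have "\<dots> \<le> real (n + 1) * ln 2"
        using ln2_ge_two_thirds by (intro mult_left_mono) auto
      finally show ?thesis by simp
    qed
    also have "\<dots> = 2 ^ (n + 1)" by (subst exp_of_nat_mult) simp
    finally show ?thesis .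
  qed
  have "\<exists>b. (\<forall>j\<le>n. b j \<in> {-1, 0, 1}) \<and> (\<exists>j\<le>n. b j \<noteq> 0) \<and>
    (\<forall>k<m. \<bar>\<Sum>i\<le>K. (\<Sum>j\<le>n. b j * a j * y i ^ j) * (real i / real K) ^ k\<bar> < \<delta>)"
  proof (rule exists_small_moments[OF a _ _ big])
    show "0 \<le> y i \<and> y i \<le> 1" if "i \<le> K" for i using yi[OF that] by simp
  qed (simp_all add: \<delta>_def)
  then obtain b where b: "\<And>j. j \<le> n \<Longrightarrow> b j \<in> {-1, 0, 1}" and nz: "\<exists>j\<le>n. b j \<noteq> 0"
    and mom: "\<And>k. k < m \<Longrightarrow> \<bar>\<Sum>i\<le>K. (\<Sum>j\<le>n. b j * a j * y i ^ j) * (real i / real K) ^ k\<bar> < \<delta>"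
    by blast
  define f where "f z = (\<Sum>j\<le>n. b j * a j * z ^ j)" for z
  have cont: "isCont f x" for x unfolding f_def by (intro continuous_intros)
  have "\<exists>j\<le>n. b j * a j \<noteq> 0" using nz a by fastforce
  then have fin: "finite {x. f x = 0}"
    unfolding f_def by (subst polyfun_finite_roots) auto
  obtain i where i: "i \<le> K" "exp (- 1718 * \<Lambda>) \<le> \<bar>f (y i)\<bar>"
  proof -
    define d where "d = (LEAST j. b j \<noteq> 0)"
    obtain j0 where j0: "j0 \<le> n" "b j0 \<noteq> 0" using nz by blast
    have d: "b d \<noteq> 0" unfolding d_def using j0(2) by (rule LeastI)
    have "d \<le> j0" unfolding d_def using j0(2) by (rule Least_le)
    then have "d \<le> n" using j0(1) by simp
    have below: "b j * a j = 0" if "j < d" for j using not_less_Least[of j "\<lambda>j. b j \<noteq> 0"] that unfolding d_def by auto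
    \<comment> \<open>Dividing by \<open>z ^ d\<close> moves the lowest nonzero coefficient to index
      0, where its absolute value is \<open>a d \<ge> 1\<close>. Zero padding keeps the length
      \<open>n\<close>. The factor \<open>y i ^ d\<close> lost here is at least
      \<open>exp (- 2 * \<Lambda>)\<close>.\<close>
    let ?c = "\<lambda>j. if j + d \<le> n then b (j + d) * a (j + d) else 0"
    have "\<exists>i\<le>p * (D - 2). \<bar>\<Sum>j\<le>n. ?c j * exp (- (3 * \<alpha> / 2 + real i * h)) ^ j\<bar> \<ge> 1 / (2 * exp (7 * real p * real D))"
      unfolding h_def
    proof (rule polynomial_large_at_node[OF \<alpha>(1) D(1,2) _ M L p(1)])
      show "4 \<le> D" using D by linarith
      show "1 \<le> \<bar>?c 0\<bar>" 
      proof -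
        have "\<bar>b d\<bar> = 1" using b[OF \<open>d \<le> n\<close>] d by auto
        then show ?thesis using a[OF \<open>d \<le> n\<close>] \<open>d \<le> n\<close> by (simp add: abs_mult)
      qed
      show "\<bar>?c j\<bar> \<le> M" for j
      proof (cases "j + d \<le> n")
        case True
        have "\<bar>b (j + d)\<bar> \<le> 1" using b[OF True] by auto
        then have "\<bar>b (j + d)\<bar> * \<bar>a (j + d)\<bar> \<le> 1 * M" using a[OF True] by (intro mult_mono) auto
        then show ?thesis using True by (simp add: abs_mult)
      qed (use M1 in simp)
    qed
    then obtain i where i: "i \<le> K" "1 / (2 * exp (7 * real p * real D)) \<le> \<bar>\<Sum>j\<le>n. ?c j * y i ^ j\<bar>"
      unfolding K_def y_def by blast
    have "exp (- (2 * \<Lambda>)) = exp (- (2 * \<alpha>)) ^ n"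
      unfolding \<Lambda>(3)[symmetric] by (simp only: exp_of_nat_mult[symmetric]) simp
    also have "\<dots> \<le> exp (- (2 * \<alpha>)) ^ d" using \<open>d \<le> n\<close> \<alpha> by (intro power_decreasing) auto
    also have "\<dots> \<le> y i ^ d" using yi[OF i(1)] by (intro power_mono) auto
    finally have yd: "exp (- (2 * \<Lambda>)) \<le> y i ^ d" .
    \<comment> \<open>Here \<open>1715 = 7 * 245\<close>; one more \<open>\<Lambda>\<close> absorbs
      the factor 2, and two more pay for \<open>y i ^ d\<close>, which gives 1718.\<close>
    have "2 * exp (7 * real p * real D) \<le> exp \<Lambda> * exp (1715 * \<Lambda>)"
    proof (intro mult_mono)
      show "2 \<le> exp \<Lambda>" using exp_ge_add_one_self[of \<Lambda>] \<Lambda>(1) by linarith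
      show "exp (7 * real p * real D) \<le> exp (1715 * \<Lambda>)" 
        unfolding exp_le_cancel_iff mult.assoc using pD by linarith
    qed auto
    also have "\<dots> = exp (1716 * \<Lambda>)" by (simp add: exp_add[symmetric])
    finally have "1 / exp (1716 * \<Lambda>) \<le> 1 / (2 * exp (7 * real p * real D))"
      by (intro divide_left_mono) auto
    with i(2) have "exp (- 1716 * \<Lambda>) \<le> \<bar>\<Sum>j\<le>n. ?c j * y i ^ j\<bar>"
      by (simp add: exp_minus inverse_eq_divide)
    then have "exp (- (2 * \<Lambda>)) * exp (- 1716 * \<Lambda>) \<le> y i ^ d * \<bar>\<Sum>j\<le>n. ?c j * y i ^ j\<bar>"
      using yd yi(2)[OF i(1)] by (intro mult_mono) auto
    also have "\<dots> = \<bar>f (y i)\<bar>"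
      unfolding f_def using polyfun_factor_lowest[of d "\<lambda>j. b j * a j" n "y i"] below \<open>d \<le> n\<close> yi(2)[OF i(1)]
      by (simp add: abs_mult)
    finally have "exp (- 1718 * \<Lambda>) \<le> \<bar>f (y i)\<bar>" by (simp add: exp_add[symmetric])
    then show thesis using i(1) that by blast
  qed
  obtain H X \<sigma> where H: "H \<subseteq> {..<K}" "\<sigma> \<in> {-1, 1::real}" and X: "finite X" "card X = card H"
    "X \<subseteq> {x. y K < x \<and> x < y 0 \<and> changes_sign_at f x}"
    and pattern: "\<And>i. i \<le> K \<Longrightarrow> 0 \<le> \<sigma> * f (y i) * (\<Prod>h\<in>H. real i - real h - 1/2)"
    using sign_pattern[of f y K] cont fin y_dec by blast
  have "m \<le> card H"
  proof (rule ccontr)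
    assume "\<not> m \<le> card H"
    then have "\<bar>f (y i)\<bar> \<le> \<delta> * exp (8 * real K)"
      using mom
      by (intro abs_le_of_small_moments[OF K1 H(1) _ H(2) pattern _ i(1), of m])
        (auto simp: f_def intro: less_imp_le)
    also have "\<dots> \<le> \<delta> * exp (1960 * \<Lambda>)" using K by (intro mult_left_mono) (auto simp: \<delta>_def)
    also have "\<dots> = exp (- 1740 * \<Lambda>)" by (simp add: \<delta>_def exp_add[symmetric])
    also have "\<dots> < exp (- 1718 * \<Lambda>)" using \<Lambda>(1) by simp
    finally show False using i(2) by simp
  qed
  also have "card H \<le> card (sign_changes_in f {1 - 2 * \<alpha> <..< 1 - \<alpha>})"
    unfolding X(2)[symmetric]
  proof (rule card_mono)
    have "sign_changes_in f {1 - 2 * \<alpha> <..< 1 - \<alpha>} \<subseteq> {x. f x = 0}"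
      unfolding sign_changes_in_def using changes_sign_at_imp_zero cont by blast
    then show "finite (sign_changes_in f {1 - 2 * \<alpha> <..< 1 - \<alpha>})" using fin finite_subset by blast
    show "X \<subseteq> sign_changes_in f {1 - 2 * \<alpha> <..< 1 - \<alpha>}"
      unfolding sign_changes_in_def using X(3) y0 yK by fastforce
  qed
  finally show ?thesis using b unfolding f_def by blast
qed

theorem theorem2p1:
  shows "\<exists>c::real. c > 0 \<and>
    (\<forall>(n::nat) (M::real) (a :: nat \<Rightarrow> real).
       n \<ge> 1 \<and> 1 \<le> M \<and> M \<le> 1/4 * exp (real n / 9) \<and> (\<forall>j\<le>n. a j \<in> {1..M}) \<longrightarrow>
       (let \<alpha> = sqrt (ln (4 * M) / real n);
            I = {1 - 2 * \<alpha> <..< 1 - \<alpha>}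
        in \<exists>b :: nat \<Rightarrow> real. (\<forall>j\<le>n. b j \<in> {-1, 0, 1}) \<and>
             real (card (sign_changes_in (\<lambda>z. \<Sum>j\<le>n. b j * a j * z ^ j) I))
               \<ge> c * sqrt (real n / ln (4 * M)) - 1))"
proof (intro exI[of _ "1/8000"] conjI allI impI)
  fix n :: nat and M :: real and a :: "nat \<Rightarrow> real"
  assume A: "n \<ge> 1 \<and> 1 \<le> M \<and> M \<le> 1/4 * exp (real n / 9) \<and> (\<forall>j\<le>n. a j \<in> {1..M})"
  define L where "L = ln (4 * M)"
  define \<alpha> where "\<alpha> = sqrt (L / real n)"
  have eL: "4 * M = exp L" using A by (simp add: L_def)
  have L: "1 \<le> L"
  proof -
    have "exp 1 \<le> 4 * M" using exp_le A by linarith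
    then show ?thesis using eL by simp
  qed
  have "exp L \<le> exp (real n / 9)" using A eL by linarith
  then have "L \<le> real n / 9" by simp
  then have "L / real n \<le> (1/3)\<^sup>2" using A by (simp add: field_simps power2_eq_square)
  then have "\<alpha> \<le> sqrt ((1/3)\<^sup>2)" unfolding \<alpha>_def by (rule real_sqrt_le_mono)
  then have \<alpha>: "0 < \<alpha>" "\<alpha> \<le> 1/3" unfolding \<alpha>_def using L A by auto
  have n: "real n * \<alpha>\<^sup>2 = L" unfolding \<alpha>_def using L A by simp
  \<comment> \<open>The largest \<open>m\<close> allowed by
    \<open>8000 * \<alpha> * m \<le> 1\<close>; rounding down accounts for the \<open>- 1\<close> in
    the conclusion.\<close>
  define m where "m = nat \<lfloor>1 / (8000 * \<alpha>)\<rfloor>"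
  have m: "real m \<le> 1 / (8000 * \<alpha>)" "1 / (8000 * \<alpha>) - 1 \<le> real m"
    unfolding m_def using \<alpha> by (auto simp: le_nat_floor)
  have "8000 * \<alpha> * real m \<le> 1" using m(1) \<alpha> by (simp add: field_simps)
  then obtain b where b: "\<forall>j\<le>n. b j \<in> {-1, 0, 1::real}"
    "m \<le> card (sign_changes_in (\<lambda>z. \<Sum>j\<le>n. b j * a j * z ^ j) {1 - 2 * \<alpha> <..< 1 - \<alpha>})"
    using exists_many_sign_changes[OF \<alpha> L eL n, of a m] A by auto
  have "sqrt (real n / L) = 1 / \<alpha>" unfolding \<alpha>_def by (simp add: real_sqrt_divide)
  then have "1/8000 * sqrt (real n / L) - 1 \<le> real m" using m(2) by simp
  also have "\<dots> \<le> real (card (sign_changes_in (\<lambda>z. \<Sum>j\<le>n. b j * a j * z ^ j) {1 - 2 * \<alpha> <..< 1 - \<alpha>}))"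
    using b(2) by simp
  finally show "let \<alpha> = sqrt (ln (4 * M) / real n);
            I = {1 - 2 * \<alpha> <..< 1 - \<alpha>}
        in \<exists>b :: nat \<Rightarrow> real. (\<forall>j\<le>n. b j \<in> {-1, 0, 1}) \<and>
             real (card (sign_changes_in (\<lambda>z. \<Sum>j\<le>n. b j * a j * z ^ j) I))
               \<ge> 1/8000 * sqrt (real n / ln (4 * M)) - 1"
    using b(1) unfolding Let_def L_def[symmetric] \<alpha>_def[symmetric] by blast
qed simp

end
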